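(* Let $\varrho\ge0$, let $g:\mathbb{R}^n\to(-\infty,\infty]$ be a $\varrho$-weakly convex function, and let $\{x^k\}$ be a sequence generated by the inexact proximal point method (described in the context) applied to $g$, with $\varepsilon_1\le r_1$ and $\theta\le\mu$. Assume that the Moreau envelope $e_\lambda g$ satisfies the KL property at some accumulation point $\bar x$ of $\{x^k\}$. Then the entire sequence $\{x^k\}$ converges to $\bar x$, and $\bar x$ is a stationary point of $g$. If moreover the set $\mathbb{N}\setminus\mathcal{N}$ of non-null iterations is infinite and the function $\psi$ in the KL property is $\psi(t)=Mt^{1-q}$ for some $M>0$ and $q\in(0,1)$, then, writing $\mathbb{N}\setminus\mathcal{N}=\{j_1<j_2<\cdots\}$ and $z^k:=x^{j_k}$, the following convergence rates hold: (i) If $q\in(0,1/2]$, then $\{z^k\}$ converges linearly to $\bar x$, i.e., there are $c>0$ and $\beta\in(0,1)$ such that $\|z^k-\bar x\|\le c\beta^k$ for all large $k\in\mathbb{N}$. (ii) If $q\in(1/2,1)$, then there exists $\gamma>0$ such that $\|z^k-\bar x\|\le\gamma k^{-\frac{1-q}{2q-1}}$ for all large $k\in\mathbb{N}$.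
   Context: $\mathbb{R}^n$ carries the Euclidean norm; $\mathbb{N}=\{1,2,\ldots\}$; $0^{-1}:=\infty$. A proper lower semicontinuous function $g:\mathbb{R}^n\to(-\infty,\infty]$ is $\varrho$-weakly convex if $g(\cdot)+\frac{\varrho}{2}\|\cdot\|^2$ is convex. For $\lambda\in(0,\varrho^{-1})$, the Moreau envelope is $e_\lambda g(x):=\inf_{y}\{g(y)+\frac1{2\lambda}\|y-x\|^2\}$ (it is $\mathcal{C}^1$-smooth) and the proximal mapping $\mathrm{Prox}_{\lambda g}(x):=\operatorname{argmin}_{y}\{g(y)+\frac{1}{2\lambda}\|y-x\|^2\}$ is single-valued. Stationary point: $\bar x$ with $0\in\partial g(\bar x)$, where $\partial g$ is the limiting (Mordukhovich) subdifferential; for weakly convex $g$ it coincides with the regular (Fréchet) subdifferential $\{v:\liminf_{x\to\bar x}\frac{g(x)-g(\bar x)-\langle v,x-\bar x\rangle}{\|x-\bar x\|}\ge0\}$, $\bar x\in\operatorname{dom} g$. KL property (for a $\mathcal{C}^1$-smooth $h:\mathbb{R}^n\to\mathbb{R}$) at $\bar x$: there exist $\eta\in(0,\infty]$, a neighborhood $U$ of $\bar x$, and a concave continuous $\psi:[0,\eta)\to[0,\infty)$ with $\psi(0)=0$, $\psi$ $\mathcal{C}^1$-smooth on $(0,\eta)$, $\psi'>0$ on $(0,\eta)$, such that $\psi'(h(x)-h(\bar x))\|\nabla h(x)\|\ge1$ for all $x\in U$ with $h(\bar x)<h(x)<h(\bar x)+\eta$. Inexact proximal point method. Parameters: $\lambda\in(0,\varrho^{-1})$,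 $0<\tau_1\le\tau_2<2\lambda$, $x^1\in\mathbb{R}^n$, $\varepsilon_1,r_1>0$, $\mu,\theta\in(0,1)$. For each $k\in\mathbb{N}$: - choose any $p^k\in\mathbb{R}^n$ with $\|p^k-\mathrm{Prox}_{\lambda g}(x^k)\|\le\lambda\varepsilon_k$ and put $g^k:=\lambda^{-1}(x^k-p^k)$; - if $\|g^k\|\le r_k+\varepsilon_k$, set $r_{k+1}:=\mu r_k$, $\varepsilon_{k+1}:=\theta\varepsilon_k$, $d^k:=0$; otherwise set $r_{k+1}:=r_k$, $\varepsilon_{k+1}:=\varepsilon_k$, $d^k:=-\frac{\|g^k\|-\varepsilon_k}{\|g^k\|}g^k$; - choose any $t_k\in[\tau_1,\tau_2]$ and set $x^{k+1}:=x^k+t_kd^k$. Null iterations: $\mathcal{N}:=\{k\in\mathbb{N}: x^{k+1}=x^k\}$. *)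

theory Defs
  imports "HOL-Analysis.Analysis"
begin

definition proper :: "('a \<Rightarrow> ereal) \<Rightarrow> bool" where
  "proper g \<longleftrightarrow> (\<forall>x. g x \<noteq> -\<infinity>) \<and> (\<exists>x. g x \<noteq> \<infinity>)"

definition lower_semicontinuous :: "('a::topological_space \<Rightarrow> ereal) \<Rightarrow> bool" where
  "lower_semicontinuous g \<longleftrightarrow> (\<forall>x. g x \<le> Liminf (at x) g)"

text \<open>
  The weights are kept strictly positive, so that the convention \<open>0 * \<infinity> = 0\<close> plays no role; the
  sum is never of the form \<open>\<infinity> - \<infinity>\<close> for a function that avoids the value \<open>-\<infinity>\<close>.
\<close>

definition ereal_convex :: "('a::real_vector \<Rightarrow> ereal) \<Rightarrow> bool" where
  "ereal_convex f \<longleftrightarrow> (\<forall>x y u v. 0 < u \<longrightarrow> 0 < v \<longrightarrow> u + v = 1 \<longrightarrow>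
     f (u *\<^sub>R x + v *\<^sub>R y) \<le> ereal u * f x + ereal v * f y)"

definition weakly_convex :: "real \<Rightarrow> ('a::real_normed_vector \<Rightarrow> ereal) \<Rightarrow> bool" where
  "weakly_convex \<rho> g \<longleftrightarrow> proper g \<and> lower_semicontinuous g \<and>
     ereal_convex (\<lambda>x. g x + ereal (\<rho> / 2 * (norm x)\<^sup>2))"

text \<open>
  For \<open>g\<close> \<open>\<rho>\<close>-weakly convex and \<open>0 < lam < 1 / \<rho>\<close> the infimum is finite everywhere, so that
  \<^const>\<open>real_of_ereal\<close> turns the envelope into a real function without changing its values.
\<close>

definition moreau_envelope :: "real \<Rightarrow> ('a::real_normed_vector \<Rightarrow> ereal) \<Rightarrow> 'a \<Rightarrow> ereal" where
  "moreau_envelope lam g x = (INF y. g y + ereal (1 / (2 * lam) * (norm (y - x))\<^sup>2))"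

text \<open>
  The proximal mapping as a point-valued map: the minimizer is unique when \<open>g\<close> is
  \<open>\<rho>\<close>-weakly convex and \<open>0 < lam < 1 / \<rho>\<close>; in other cases the value is an arbitrary choice.
\<close>

definition prox :: "real \<Rightarrow> ('a::real_normed_vector \<Rightarrow> ereal) \<Rightarrow> 'a \<Rightarrow> 'a" where
  "prox lam g x = arg_min (\<lambda>y. g y + ereal (1 / (2 * lam) * (norm (y - x))\<^sup>2)) (\<lambda>_. True)"

text \<open>Points of the domain are those with \<open>\<bar>g x\<bar> \<noteq> \<infinity>\<close>, since the functions considered are proper.\<close>

definition regular_subdiff :: "('a::real_inner \<Rightarrow> ereal) \<Rightarrow> 'a \<Rightarrow> 'a set" where
  "regular_subdiff g x = {v. \<bar>g x\<bar> \<noteq> \<infinity> \<and>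
     0 \<le> Liminf (at x) (\<lambda>y. (g y - g x - ereal (v \<bullet> (y - x))) / ereal (norm (y - x)))}"

definition limiting_subdiff :: "('a::real_inner \<Rightarrow> ereal) \<Rightarrow> 'a \<Rightarrow> 'a set" where
  "limiting_subdiff g x = {v. \<bar>g x\<bar> \<noteq> \<infinity> \<and>
     (\<exists>y w. y \<longlonglongrightarrow> x \<and> (\<lambda>k. g (y k)) \<longlonglongrightarrow> g x \<and>
            (\<forall>k::nat. w k \<in> regular_subdiff g (y k)) \<and> w \<longlonglongrightarrow> v)}"

definition stationary_point :: "('a::real_inner \<Rightarrow> ereal) \<Rightarrow> 'a \<Rightarrow> bool" where
  "stationary_point g x \<longleftrightarrow> 0 \<in> limiting_subdiff g x"

definition gradient :: "('a::real_inner \<Rightarrow> real) \<Rightarrow> 'a \<Rightarrow> 'a" where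
  "gradient h x = (THE D. GDERIV h x :> D)"

text \<open>The property at \<open>a\<close> with the interval length \<open>\<eta>\<close> and the desingularizing function \<open>\<psi>\<close> exhibited.\<close>

definition KL_with :: "('a::real_inner \<Rightarrow> real) \<Rightarrow> 'a \<Rightarrow> ereal \<Rightarrow> (real \<Rightarrow> real) \<Rightarrow> bool" where
  "KL_with h a \<eta> \<psi> \<longleftrightarrow>
     0 < \<eta> \<and>
     concave_on {s. 0 \<le> s \<and> ereal s < \<eta>} \<psi> \<and>
     continuous_on {s. 0 \<le> s \<and> ereal s < \<eta>} \<psi> \<and>
     (\<forall>s. 0 \<le> s \<and> ereal s < \<eta> \<longrightarrow> 0 \<le> \<psi> s) \<and>
     \<psi> 0 = 0 \<and>
     \<psi> C1_differentiable_on {s. 0 < s \<and> ereal s < \<eta>} \<and>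
     (\<forall>s. 0 < s \<and> ereal s < \<eta> \<longrightarrow> 0 < deriv \<psi> s) \<and>
     (\<exists>U. open U \<and> a \<in> U \<and>
        (\<forall>x\<in>U. h a < h x \<and> ereal (h x) < ereal (h a) + \<eta> \<longrightarrow>
           1 \<le> deriv \<psi> (h x - h a) * norm (gradient h x)))"

text \<open>
  All sequences are indexed from 1; their values at index 0 are irrelevant.
\<close>

definition inexact_ppm ::
  "('a::real_normed_vector \<Rightarrow> ereal) \<Rightarrow> real \<Rightarrow> real \<Rightarrow> real \<Rightarrow> real \<Rightarrow> real \<Rightarrow>
   (nat \<Rightarrow> 'a) \<Rightarrow> (nat \<Rightarrow> 'a) \<Rightarrow> (nat \<Rightarrow> 'a) \<Rightarrow> (nat \<Rightarrow> real) \<Rightarrow> (nat \<Rightarrow> real) \<Rightarrow> (nat \<Rightarrow> real) \<Rightarrow> bool"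
where
  "inexact_ppm g lam \<tau>1 \<tau>2 \<mu> \<theta> x p d t r \<epsilon> \<longleftrightarrow>
     (\<forall>k\<ge>1.
        norm (p k - prox lam g (x k)) \<le> lam * \<epsilon> k \<and>
        (let gk = inverse lam *\<^sub>R (x k - p k) in
           if norm gk \<le> r k + \<epsilon> k
           then r (Suc k) = \<mu> * r k \<and> \<epsilon> (Suc k) = \<theta> * \<epsilon> k \<and> d k = 0
           else r (Suc k) = r k \<and> \<epsilon> (Suc k) = \<epsilon> k \<and>
                d k = - (((norm gk - \<epsilon> k) / norm gk) *\<^sub>R gk)) \<and>
        \<tau>1 \<le> t k \<and> t k \<le> \<tau>2 \<and>
        x (Suc k) = x k + t k *\<^sub>R d k)"

definition accumulation_point :: "(nat \<Rightarrow> 'a::topological_space) \<Rightarrow> 'a \<Rightarrow> bool" where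
  "accumulation_point x a \<longleftrightarrow> (\<exists>s. strict_mono s \<and> (x \<circ> s) \<longlonglongrightarrow> a)"

definition null_iterations :: "(nat \<Rightarrow> 'a) \<Rightarrow> nat set" where
  "null_iterations x = {k. 1 \<le> k \<and> x (Suc k) = x k}"

definition nonnull_iterations :: "(nat \<Rightarrow> 'a) \<Rightarrow> nat set" where
  "nonnull_iterations x = {1..} - null_iterations x"

text \<open>
  For \<open>k \<ge> 1\<close> this is the iterate at the \<open>k\<close>-th non-null iteration; \<^const>\<open>enumerate\<close> counts from 0.
\<close>

definition nonnull_iterate :: "(nat \<Rightarrow> 'a) \<Rightarrow> nat \<Rightarrow> 'a" where
  "nonnull_iterate x k = x (enumerate (nonnull_iterations x) (k - 1))"

end

theory Submission
  imports Defs
begin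

text \<open>
  The Moreau envelope \<open>E\<close> is differentiable with continuous gradient \<open>G x = (x - P x) / lam\<close>, where
  \<open>P\<close> is the proximal mapping, and testing the infimum at \<open>y\<close> with \<open>P x\<close> gives the one-sided
  quadratic bound \<open>E y \<le> E x + G x \<bullet> (y - x) + (norm (y - x))\<^sup>2 / (2 * lam)\<close>. Hence the method is an
  inexact gradient method for \<open>E\<close>. Since \<open>\<epsilon> k \<le> r k\<close> throughout, a non-null step satisfies
  \<open>norm (G (x k)) \<le> 3 * norm (d k)\<close> and decreases \<open>E\<close> by a multiple of \<open>(norm (d k))\<^sup>2\<close>, while a null
  step leaves \<open>x k\<close> unchanged; so the whole sequence has the strong descent property of the
  Kurdyka-Lojasiewicz argument, which gives convergence and the bound of \<open>norm (x k - xbar)\<close> by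
  \<open>\<psi> (E (x k) - E xbar)\<close>. For \<open>\<psi> s = M * s powr (1 - q)\<close> the gaps \<open>\<Delta> k\<close> of \<open>E\<close> along the non-null
  iterates satisfy \<open>c * \<Delta> k powr (2 * q) \<le> \<Delta> k - \<Delta> (Suc k)\<close>, and the rates follow.
\<close>

subsection \<open>Lower semicontinuous and convex functions\<close>

lemma lower_semicontinuous_open:
  assumes "lower_semicontinuous f"
  shows "open {y. c < f y}"
proof (rule Topological_Spaces.topological_space_class.openI)
  fix x assume "x \<in> {y. c < f y}"
  then have cx: "c < f x" by simp
  then have "c < Liminf (at x) f"
    using assms unfolding lower_semicontinuous_def by (meson less_le_trans)
  then have "eventually (\<lambda>y. c < f y) (at x)" by (rule less_LiminfD)
  then obtain S where "open S" "x \<in> S" "\<forall>y\<in>S. y \<noteq> x \<longrightarrow> c < f y"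
    unfolding eventually_at_topological by auto
  with cx show "\<exists>T. open T \<and> x \<in> T \<and> T \<subseteq> {y. c < f y}"
    by (intro exI[of _ S]) auto
qed

lemma lower_semicontinuous_add_continuous:
  fixes q :: "'a::topological_space \<Rightarrow> real"
  assumes "lower_semicontinuous f" and "continuous_on UNIV q"
  shows "lower_semicontinuous (\<lambda>y. f y + ereal (q y))"
  unfolding lower_semicontinuous_def le_Liminf_iff
proof (intro allI impI)
  fix x c assume "c < f x + ereal (q x)"
  then obtain c' where c': "c < ereal c'" "ereal c' < f x + ereal (q x)"
    using ereal_dense2 by blast
  then have "ereal (c' - q x) < f x"
    by (cases "f x") auto
  \<comment> \<open>The number \<open>b\<close> splits the bound \<open>c'\<close>: near
    \<open>x\<close>, \<open>f\<close> stays above \<open>b\<close> and \<open>q\<close> above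
    \<open>c' - b\<close>, so no sum of two infinite values has to be handled.\<close>
  then obtain b where b: "c' - q x < b" "ereal b < f x"
    using ereal_dense2 by force
  have "open {y. ereal b < f y}" using assms(1) by (rule lower_semicontinuous_open)
  then have 1: "eventually (\<lambda>y. ereal b < f y) (at x)"
    unfolding eventually_at_topological using b by blast
  have "(q \<longlongrightarrow> q x) (at x)"
    using assms(2) by (simp add: continuous_on_def)
  then have 2: "eventually (\<lambda>y. c' - b < q y) (at x)"
    using b by (intro order_tendstoD(1)) auto
  show "eventually (\<lambda>y. c < f y + ereal (q y)) (at x)"
    using 1 2
  proof eventually_elim
    case (elim y)
    then have "ereal c' < f y + ereal (q y)" by (cases "f y") auto
    with c'(1) show ?case by (rule less_trans)
  qed
qed

text \<open>If no point of \<open>K\<close> were minimal, the open sets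
  \<open>{y. f z < f y}\<close> with \<open>z\<close> in \<open>K\<close> would cover it; in a
  finite subcover the index with the least value is left uncovered.\<close>

lemma lower_semicontinuous_attains_min:
  fixes f :: "'a::topological_space \<Rightarrow> ereal"
  assumes "lower_semicontinuous f" "compact K" "K \<noteq> {}"
  obtains y where "y \<in> K" "\<And>z. z \<in> K \<Longrightarrow> f y \<le> f z"
proof (rule ccontr)
  assume "\<not> thesis"
  with that have "\<forall>y\<in>K. \<exists>z\<in>K. f z < f y" by (meson not_less)
  then have cover: "K \<subseteq> (\<Union>z\<in>K. {y. f z < f y})" by blast
  obtain D where D: "D \<subseteq> K" "finite D" "K \<subseteq> (\<Union>z\<in>D. {y. f z < f y})"
    using assms(2) lower_semicontinuous_open[OF assms(1)] cover by (rule compactE_image)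
  then have "D \<noteq> {}" using assms(3) by auto
  then obtain z where z: "z \<in> D" "\<And>w. w \<in> D \<Longrightarrow> f z \<le> f w"
    using D(2) arg_min_if_finite(1)[of D f] arg_min_least[of D _ f] that by blast
  then obtain w where "w \<in> D" "f w < f z" using D by blast
  with z(2) show False by (meson leD)
qed

text \<open>The value at \<open>y\<close> is controlled by convexity along the segment from \<open>y0\<close> to \<open>y\<close>, using a lower
  bound on the unit ball around \<open>y0\<close>.\<close>

lemma ereal_convex_lower_bound:
  fixes f :: "'a::euclidean_space \<Rightarrow> ereal"
  assumes "ereal_convex f" "lower_semicontinuous f" "proper f"
  obtains A B where "0 \<le> A" "0 \<le> B" "\<And>y. ereal (- A - B * norm y) \<le> f y"
proof -
  obtain y0 where "f y0 \<noteq> \<infinity>" "f y0 \<noteq> -\<infinity>" using assms(3) unfolding proper_def by auto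
  then obtain h0 where h0: "f y0 = ereal h0" by (cases "f y0") auto
  obtain ym where ym: "ym \<in> cball y0 1" "\<And>z. z \<in> cball y0 1 \<Longrightarrow> f ym \<le> f z"
    by (rule lower_semicontinuous_attains_min[OF assms(2), of "cball y0 1"]) auto
  then have "f ym \<le> f y0" by simp
  moreover have "f ym \<noteq> -\<infinity>" using assms(3) unfolding proper_def by auto
  ultimately obtain m where m: "f ym = ereal m" "m \<le> h0"
    using h0 by (cases "f ym") auto
  have bound: "ereal (h0 - (h0 - m) * (norm (y - y0) + 1)) \<le> f y" for y
  proof (cases "norm (y - y0) \<le> 1")
    case True
    then have "ereal m \<le> f y" using ym(2)[of y] m by (simp add: dist_norm norm_minus_commute)
    moreover have "h0 - (h0 - m) * (norm (y - y0) + 1) \<le> m"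
      using m(2) mult_left_mono[of 1 "norm (y - y0) + 1" "h0 - m"] by simp
    ultimately show ?thesis by (meson ereal_less_eq(3) order_trans)
  next
    case False
    define N where "N = norm (y - y0)"
    have N: "1 < N" using False N_def by simp
    show ?thesis
    proof (cases "f y")
      case (real fy)
      define z where "z = (1/N) *\<^sub>R y + (1 - 1/N) *\<^sub>R y0"
      have "z - y0 = (1/N) *\<^sub>R (y - y0)" unfolding z_def by (simp add: algebra_simps)
      then have "norm (z - y0) = 1" using N unfolding N_def by auto
      then have "ereal m \<le> f z" using ym(2)[of z] m by (simp add: dist_norm norm_minus_commute)
      also have "f z \<le> ereal (1/N) * f y + ereal (1 - 1/N) * f y0"
        unfolding z_def using assms(1) N unfolding ereal_convex_def by simp
      finally have "m \<le> (1/N) * fy + (1 - 1/N) * h0" using real h0 by simp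
      then have "N * m \<le> N * ((1/N) * fy + (1 - 1/N) * h0)" using N by simp
      also have "\<dots> = fy + (N - 1) * h0" using N by (simp add: field_simps)
      finally have "h0 - (h0 - m) * (N + 1) \<le> fy" using m(2) by (simp add: algebra_simps)
      then show ?thesis using real N_def by simp
    qed (use assms(3) in \<open>auto simp: proper_def\<close>)
  qed
  show thesis
  \<comment> \<open>The triangle inequality moves the center from \<open>y0\<close> to the origin;
    \<open>\<bar>h0\<bar>\<close> instead of \<open>- h0\<close> keeps the constant
    nonnegative.\<close>
  proof (rule that[of "\<bar>h0\<bar> + (h0 - m) * (norm y0 + 1)" "h0 - m"])
    show "ereal (- (\<bar>h0\<bar> + (h0 - m) * (norm y0 + 1)) - (h0 - m) * norm y) \<le> f y" for y
    proof -
      have "(h0 - m) * (norm (y - y0) + 1) \<le> (h0 - m) * (norm y + norm y0 + 1)"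
        using m(2) norm_triangle_ineq4[of y y0] by (intro mult_left_mono) auto
      then have "- (\<bar>h0\<bar> + (h0 - m) * (norm y0 + 1)) - (h0 - m) * norm y
        \<le> h0 - (h0 - m) * (norm (y - y0) + 1)" by (simp add: algebra_simps)
      with bound[of y] show ?thesis by (meson ereal_less_eq(3) order_trans)
    qed
  qed (use m(2) in auto)
qed

text \<open>Supplies the radius outside which the proximal objective is at least a given reference
  value.\<close>

lemma quadratic_dominates_affine:
  fixes a b c N :: real
  assumes "0 < a" "0 \<le> b" "0 \<le> c" "1 \<le> N" "(b + c) / a \<le> N"
  shows "b * N + c \<le> a * N\<^sup>2"
proof -
  have "b * N + c \<le> (b + c) * N" using mult_left_mono[OF assms(4,3)] by (simp add: algebra_simps)
  also have "\<dots> \<le> (a * N) * N" using assms by (intro mult_right_mono) (auto simp: field_simps)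
  finally show ?thesis by (simp add: power2_eq_square mult_ac)
qed

text \<open>The last term is the exact gain of the squared norm over mere convexity; it is the
  source of the strong convexity used for the proximal objective.\<close>

lemma norm_convex_combination_sq:
  fixes u v w :: "'a::real_inner"
  shows "(norm ((1 - s) *\<^sub>R u + s *\<^sub>R v - w))\<^sup>2 =
    (1 - s) * (norm (u - w))\<^sup>2 + s * (norm (v - w))\<^sup>2 - s * (1 - s) * (norm (v - u))\<^sup>2"
  unfolding power2_norm_eq_inner
  by (simp add: inner_simps inner_commute algebra_simps power2_eq_square)

subsection \<open>The Moreau envelope of a weakly convex function\<close>

locale weakly_convex_prox =
  fixes g :: "'a::euclidean_space \<Rightarrow> ereal" and \<rho> lam :: real
  assumes wc: "weakly_convex \<rho> g"
    and lam_pos: "0 < lam" and lam_rho: "lam * \<rho> < 1"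
begin

abbreviation P where "P \<equiv> prox lam g"

definition E :: "'a \<Rightarrow> real" where
  "E = (\<lambda>x. real_of_ereal (moreau_envelope lam g x))"

definition G :: "'a \<Rightarrow> 'a" where
  "G x = inverse lam *\<^sub>R (x - P x)"

definition prox_value :: "'a \<Rightarrow> real" where
  "prox_value x = real_of_ereal (g (P x))"

section \<open>Existence of proximal points and finiteness of the envelope\<close>

lemma g_not_minf: "g x \<noteq> -\<infinity>"
  using wc unfolding weakly_convex_def proper_def by auto

text \<open>Adding \<open>\<rho> / 2 * (norm y)\<^sup>2\<close> to \<open>g\<close> gives a convex
  function with an affine lower bound in \<open>norm y\<close>. Since
  \<open>lam * \<rho> < 1\<close>, the proximal objective keeps a positive quadratic coefficient, so
  it is coercive and its minimum over a large ball is global.\<close>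

lemma prox_minimizes:
  "g (P x) + ereal (1 / (2 * lam) * (norm (P x - x))\<^sup>2) \<le> g y + ereal (1 / (2 * lam) * (norm (y - x))\<^sup>2)"
proof -
  define F where "F = (\<lambda>y. g y + ereal (1 / (2 * lam) * (norm (y - x))\<^sup>2))"
  define h where "h = (\<lambda>y. g y + ereal (\<rho> / 2 * (norm y)\<^sup>2))"
  have gprop: "proper g" and lsc: "lower_semicontinuous g" and conv: "ereal_convex h"
    using wc unfolding weakly_convex_def h_def by auto
  have "lower_semicontinuous h" unfolding h_def
    by (rule lower_semicontinuous_add_continuous[OF lsc]) (intro continuous_intros)
  moreover have "proper h" using gprop unfolding proper_def h_def by auto
  ultimately obtain A B where AB: "0 \<le> A" "0 \<le> B" "\<And>y. ereal (- A - B * norm y) \<le> h y"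
    using ereal_convex_lower_bound[OF conv] by metis
  obtain y0 where y0: "g y0 \<noteq> \<infinity>" using gprop unfolding proper_def by auto
  then obtain f0 where f0: "F y0 = ereal f0" unfolding F_def using g_not_minf[of y0]
    by (cases "g y0") auto
  \<comment> \<open>\<open>a\<close> is the quadratic coefficient left after subtracting the weak
    convexity term; \<open>b\<close> below collects the slope of the lower bound and the cross term
    of \<open>(norm (y - x))\<^sup>2\<close>.\<close>
  define a where "a = (1/lam - \<rho>) / 2"
  have a: "0 < a" unfolding a_def using lam_pos lam_rho by (simp add: field_simps)
  define b where "b = B + norm x / lam"
  have b: "0 \<le> b" unfolding b_def using AB lam_pos by simp
  have Flow: "ereal (a * (norm y)\<^sup>2 - b * norm y - A) \<le> F y" for y
  proof (cases "g y")
    case (real gy)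
    have 1: "- A - B * norm y \<le> gy + \<rho> / 2 * (norm y)\<^sup>2" using AB(3)[of y] real unfolding h_def by simp
    have "(norm (y - x))\<^sup>2 \<ge> (norm y)\<^sup>2 - 2 * (norm x * norm y)"
    proof -
      have "(norm (y - x))\<^sup>2 = (norm y)\<^sup>2 - 2 * (y \<bullet> x) + (norm x)\<^sup>2"
        unfolding power2_norm_eq_inner by (simp add: inner_simps inner_commute)
      then show ?thesis using norm_cauchy_schwarz[of y x] zero_le_power2[of "norm x"]
        by (simp only: mult.commute[of "norm x"])
    qed
    then have "1 / (2 * lam) * (norm (y - x))\<^sup>2 \<ge> 1 / (2 * lam) * ((norm y)\<^sup>2 - 2 * (norm x * norm y))"
      using lam_pos by (intro mult_left_mono) auto
    then have 2: "1 / (2 * lam) * (norm (y - x))\<^sup>2 \<ge> 1 / (2 * lam) * (norm y)\<^sup>2 - norm x / lam * norm y"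
      using lam_pos by (simp add: field_simps)
    have "a * (norm y)\<^sup>2 - b * norm y - A
        = (- A - B * norm y) - \<rho> / 2 * (norm y)\<^sup>2 + (1 / (2 * lam) * (norm y)\<^sup>2 - norm x / lam * norm y)"
      unfolding a_def b_def by (simp add: algebra_simps diff_divide_distrib)
    also have "\<dots> \<le> gy + 1 / (2 * lam) * (norm (y - x))\<^sup>2" using 1 2 by linarith
    finally show ?thesis using real unfolding F_def by simp
  qed (use g_not_minf[of y] in \<open>auto simp: F_def\<close>)
  \<comment> \<open>The ball contains \<open>y0\<close>, so the minimum over it is at most
    \<open>f0\<close>, and outside it the coercive bound is at least \<open>f0\<close>.\<close>
  define R where "R = Max {1, norm y0, (b + (A + \<bar>f0\<bar>)) / a}"
  have R: "1 \<le> R" "norm y0 \<le> R" "(b + (A + \<bar>f0\<bar>)) / a \<le> R" unfolding R_def by auto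
  have "lower_semicontinuous F" unfolding F_def
    by (rule lower_semicontinuous_add_continuous[OF lsc]) (intro continuous_intros)
  then obtain ym where ym: "ym \<in> cball 0 R" "\<And>z. z \<in> cball 0 R \<Longrightarrow> F ym \<le> F z"
    by (rule lower_semicontinuous_attains_min[where K = "cball 0 R"]) (use R in auto)
  have "F ym \<le> F z" for z
  proof (cases "z \<in> cball 0 R")
    case False
    then have "R \<le> norm z" by simp
    then have "b * norm z + (A + \<bar>f0\<bar>) \<le> a * (norm z)\<^sup>2"
      using R a b AB by (intro quadratic_dominates_affine) auto
    then have "ereal f0 \<le> ereal (a * (norm z)\<^sup>2 - b * norm z - A)" by auto
    with Flow[of z] have "F y0 \<le> F z" using f0 by (metis order_trans)
    moreover have "F ym \<le> F y0" using ym(2) R by simp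
    ultimately show ?thesis by (rule order_trans[rotated])
  qed (rule ym)
  then have "is_arg_min F (\<lambda>_. True) ym" unfolding is_arg_min_def by (simp add: leD)
  then have "is_arg_min F (\<lambda>_. True) (arg_min F (\<lambda>_. True))"
    unfolding arg_min_def by (rule someI)
  then have "F (arg_min F (\<lambda>_. True)) \<le> F y" unfolding is_arg_min_def by (simp add: not_less)
  then show ?thesis unfolding F_def prox_def .
qed

lemma g_prox: "g (P x) = ereal (prox_value x)"
proof -
  obtain y0 where "g y0 \<noteq> \<infinity>" using wc unfolding weakly_convex_def proper_def by auto
  then have "g (P x) \<noteq> \<infinity>" using prox_minimizes[of x y0] by (cases "g y0") auto
  with g_not_minf[of "P x"] show ?thesis unfolding prox_value_def by (cases "g (P x)") auto
qed

lemma E_eq: "E x = prox_value x + 1 / (2 * lam) * (norm (P x - x))\<^sup>2"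
proof -
  have "moreau_envelope lam g x = g (P x) + ereal (1 / (2 * lam) * (norm (P x - x))\<^sup>2)"
    unfolding moreau_envelope_def
    by (rule antisym, rule INF_lower, simp, rule INF_greatest, rule prox_minimizes)
  then show ?thesis unfolding E_def using g_prox by simp
qed

text \<open>The proximal objective is strongly convex with modulus \<open>1/lam - \<rho>\<close>,
  hence grows quadratically away from its minimizer. The proof compares \<open>P x\<close> with
  points of the segment towards \<open>y\<close>, divides by the parameter \<open>s\<close> and lets
  \<open>s\<close> tend to 0.\<close>

lemma prox_strong_minimality:
  assumes "g y = ereal gy"
  shows "prox_value x + 1 / (2 * lam) * (norm (P x - x))\<^sup>2 + (1/lam - \<rho>) / 2 * (norm (y - P x))\<^sup>2
    \<le> gy + 1 / (2 * lam) * (norm (y - x))\<^sup>2"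
proof -
  let ?p = "P x"
  define l where "l = 1 / (2 * lam)"
  define D where "D = gy + 1 / (2 * lam) * (norm (y - x))\<^sup>2 - (prox_value x + 1 / (2 * lam) * (norm (?p - x))\<^sup>2)"
  define K where "K = (1/lam - \<rho>) / 2 * (norm (y - ?p))\<^sup>2"
  have *: "(1 - s) * K \<le> D" if s: "0 < s" "s < 1" for s
  proof -
    define z where "z = (1 - s) *\<^sub>R ?p + s *\<^sub>R y"
    have "g z + ereal (\<rho> / 2 * (norm z)\<^sup>2) \<le>
      ereal (1 - s) * (g ?p + ereal (\<rho> / 2 * (norm ?p)\<^sup>2)) + ereal s * (g y + ereal (\<rho> / 2 * (norm y)\<^sup>2))"
      using wc s unfolding z_def weakly_convex_def ereal_convex_def by simp
    then obtain gz where gz: "g z = ereal gz"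
      and c: "gz + \<rho> / 2 * (norm z)\<^sup>2 \<le>
        (1 - s) * (prox_value x + \<rho> / 2 * (norm ?p)\<^sup>2) + s * (gy + \<rho> / 2 * (norm y)\<^sup>2)"
      using g_prox[of x] assms g_not_minf[of z] by (cases "g z") auto
    have m: "prox_value x + 1 / (2 * lam) * (norm (?p - x))\<^sup>2 \<le> gz + 1 / (2 * lam) * (norm (z - x))\<^sup>2"
      using prox_minimizes[of x z] gz g_prox by simp
    \<comment> \<open>The two expansions contribute
      \<open>s * (1 - s) * (norm (y - ?p))\<^sup>2\<close> with weights \<open>\<rho> / 2\<close>
      and \<open>1 / (2 * lam)\<close> of opposite effect; their difference is the growth
      constant.\<close>
    have n1: "(norm z)\<^sup>2 = (1 - s) * (norm ?p)\<^sup>2 + s * (norm y)\<^sup>2 - s * (1 - s) * (norm (y - ?p))\<^sup>2"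
      using norm_convex_combination_sq[of s ?p y 0] unfolding z_def by simp
    have n2: "(norm (z - x))\<^sup>2 = (1 - s) * (norm (?p - x))\<^sup>2 + s * (norm (y - x))\<^sup>2 - s * (1 - s) * (norm (y - ?p))\<^sup>2"
      using norm_convex_combination_sq[of s ?p y x] unfolding z_def by simp
    have half: "1 / lam = 2 * (1 / (2 * lam))" by simp
    have "s * ((1 - s) * K) \<le> s * D"
      using c m unfolding n1 n2 D_def K_def half l_def[symmetric]
      by (simp add: algebra_simps add_divide_distrib diff_divide_distrib)
    then show ?thesis using s by simp
  qed
  have "((\<lambda>s. (1 - s) * K) \<longlongrightarrow> (1 - 0) * K) (at_right 0)" by (intro tendsto_intros)
  moreover have "eventually (\<lambda>s::real. (1 - s) * K \<le> D) (at_right 0)"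
    using * by (auto simp: eventually_at_right_field intro!: exI[of _ 1])
  ultimately have "(1 - 0) * K \<le> D"
    by (intro tendsto_upperbound[where F = "at_right (0::real)"]) auto
  then show ?thesis unfolding D_def K_def l_def[symmetric] by (simp only: mult_1 diff_zero)
qed

text \<open>Strong minimality at \<open>x\<close> is tested with \<open>P y\<close> and at
  \<open>y\<close> with \<open>P x\<close>. In the sum the values of \<open>g\<close> cancel and the
  squared distances combine into an inner product, which Cauchy-Schwarz bounds.\<close>

lemma prox_lipschitz: "norm (P y - P x) \<le> 1 / (1 - lam * \<rho>) * norm (y - x)"
proof -
  define l where "l = 1 / (2 * lam)"
  let ?a = "1/lam - \<rho>"
  have a: "?a = (1 - lam * \<rho>) / lam" using lam_pos by (simp add: field_simps)
  have 1: "prox_value x + l * (norm (P x - x))\<^sup>2 + ?a / 2 * (norm (P y - P x))\<^sup>2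
      \<le> prox_value y + l * (norm (P y - x))\<^sup>2"
    using prox_strong_minimality[OF g_prox, of x y] unfolding l_def by simp
  have 2: "prox_value y + l * (norm (P y - y))\<^sup>2 + ?a / 2 * (norm (P y - P x))\<^sup>2
      \<le> prox_value x + l * (norm (P x - y))\<^sup>2"
    using prox_strong_minimality[OF g_prox, of y x] unfolding l_def by (simp add: norm_minus_commute)
  have "(norm (P y - x))\<^sup>2 + (norm (P x - y))\<^sup>2 - (norm (P x - x))\<^sup>2 - (norm (P y - y))\<^sup>2
      = 2 * ((P y - P x) \<bullet> (y - x))"
    unfolding power2_norm_eq_inner by (simp add: inner_simps inner_commute algebra_simps)
  then have 3: "l * (norm (P y - x))\<^sup>2 + l * (norm (P x - y))\<^sup>2 - l * (norm (P x - x))\<^sup>2 - l * (norm (P y - y))\<^sup>2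
      = l * (2 * ((P y - P x) \<bullet> (y - x)))" by (metis (no_types, opaque_lifting) distrib_left right_diff_distrib)
  have dbl: "?a * (norm (P y - P x))\<^sup>2 = 2 * (?a / 2 * (norm (P y - P x))\<^sup>2)" by simp
  have "?a * (norm (P y - P x))\<^sup>2 \<le> l * (2 * ((P y - P x) \<bullet> (y - x)))"
    unfolding dbl using 1 2 3
    by (simp only: linorder_not_less[symmetric]) argo
  also have "\<dots> = 1 / lam * ((P y - P x) \<bullet> (y - x))" unfolding l_def by simp
  also have "\<dots> \<le> 1 / lam * (norm (P y - P x) * norm (y - x))"
    using lam_pos by (intro mult_left_mono norm_cauchy_schwarz) auto
  finally have "lam * (?a * (norm (P y - P x))\<^sup>2) \<le> lam * (1 / lam * (norm (P y - P x) * norm (y - x)))"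
    using lam_pos by (intro mult_left_mono) auto
  then have "(1 - lam * \<rho>) * (norm (P y - P x))\<^sup>2 \<le> norm (P y - P x) * norm (y - x)"
    unfolding a using lam_pos by simp
  then have "norm (P y - P x) * ((1 - lam * \<rho>) * norm (P y - P x)) \<le> norm (P y - P x) * norm (y - x)"
    by (simp add: power2_eq_square mult_ac)
  then have "(1 - lam * \<rho>) * norm (P y - P x) \<le> norm (y - x)"
    by (cases "norm (P y - P x) = 0") (auto simp: mult_le_cancel_left)
  then show ?thesis using lam_rho by (simp add: field_simps)
qed

section \<open>Differentiability of the envelope and stationarity\<close>

lemma continuous_G: "continuous_on UNIV G"
proof -
  have "(1 / (1 - lam * \<rho>))-lipschitz_on UNIV P"
    using prox_lipschitz lam_rho by (intro lipschitz_onI) (auto simp: dist_norm)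
  then have "continuous_on UNIV P" by (rule lipschitz_on_continuous_on)
  then show ?thesis unfolding G_def by (intro continuous_intros)
qed

lemma E_upper: "E y \<le> E x + G x \<bullet> (y - x) + 1 / (2 * lam) * (norm (y - x))\<^sup>2"
proof -
  have "prox_value y + 1 / (2 * lam) * (norm (P y - y))\<^sup>2 \<le> prox_value x + 1 / (2 * lam) * (norm (P x - y))\<^sup>2"
    using prox_minimizes[of y "P x"] g_prox by simp
  moreover have "(norm (P x - y))\<^sup>2 = (norm (P x - x))\<^sup>2 + 2 * ((x - P x) \<bullet> (y - x)) + (norm (y - x))\<^sup>2"
    unfolding power2_norm_eq_inner by (simp add: inner_simps inner_commute algebra_simps)
  moreover have "1 / (2 * lam) * (2 * ((x - P x) \<bullet> (y - x))) = G x \<bullet> (y - x)"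
    unfolding G_def by (simp add: inverse_eq_divide)
  ultimately show ?thesis unfolding E_eq by (simp only: distrib_left)
qed

text \<open>The lower estimate comes from \<open>E_upper\<close> with \<open>x\<close> and
  \<open>y\<close> exchanged; continuity of \<open>G\<close> permits replacing \<open>G y\<close> by
  \<open>G x\<close>.\<close>

lemma E_GDERIV: "GDERIV E x :> G x"
  unfolding gderiv_def has_derivative_at_alt
proof (intro conjI allI impI)
  show "bounded_linear (\<lambda>h. h \<bullet> G x)" by (rule bounded_linear_inner_left)
  fix e :: real assume e: "0 < e"
  have "isCont G x" using continuous_G by (simp add: continuous_on_eq_continuous_at)
  then obtain \<delta> where \<delta>: "0 < \<delta>" "\<And>y. norm (y - x) < \<delta> \<Longrightarrow> norm (G y - G x) < e / 2"
    unfolding continuous_at_eps_delta dist_norm using e by (metis half_gt_zero)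
  have "norm (E y - E x - (y - x) \<bullet> G x) \<le> e * norm (y - x)"
    \<comment> \<open>Within \<open>\<delta>\<close> the change of \<open>G\<close> costs at most
      half of \<open>e\<close>; within \<open>lam * e\<close> the quadratic term costs at most the
      other half.\<close>
    if y: "norm (y - x) < min \<delta> (lam * e)" for y
  proof -
    let ?l = "1 / (2 * lam) * (norm (y - x))\<^sup>2"
    have "?l = norm (y - x) / (2 * lam) * norm (y - x)" by (simp add: power2_eq_square)
    also have "\<dots> \<le> (e / 2) * norm (y - x)"
      using y lam_pos by (intro mult_right_mono) (auto simp: field_simps)
    finally have l: "?l \<le> (e / 2) * norm (y - x)" .
    have u: "E y - E x - (y - x) \<bullet> G x \<le> ?l" using E_upper[of y x] by (simp add: inner_commute)
    have "E x \<le> E y + G y \<bullet> (x - y) + ?l" using E_upper[of x y] by (simp add: norm_minus_commute)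
    moreover have "G y \<bullet> (x - y) = - ((y - x) \<bullet> G x) - (G y - G x) \<bullet> (y - x)"
      by (simp add: inner_simps inner_commute)
    moreover have "\<bar>(G y - G x) \<bullet> (y - x)\<bar> \<le> (e / 2) * norm (y - x)"
      using Cauchy_Schwarz_ineq2[of "G y - G x" "y - x"] \<delta>(2)[of y] y
        mult_right_mono[of "norm (G y - G x)" "e/2" "norm (y - x)"] by simp
    ultimately have "- (e * norm (y - x)) \<le> E y - E x - (y - x) \<bullet> G x"
      using l by simp
    moreover have "(e / 2) * norm (y - x) \<le> e * norm (y - x)" using e by (intro mult_right_mono) auto
    ultimately show ?thesis using u l by simp
  qed
  then show "\<exists>d>0. \<forall>y. norm (y - x) < d \<longrightarrow> norm (E y - E x - (y - x) \<bullet> G x) \<le> e * norm (y - x)"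
    using \<delta>(1) e lam_pos by (intro exI[of _ "min \<delta> (lam * e)"]) auto
qed

lemma gradient_E: "gradient E x = G x"
  unfolding gradient_def
proof (rule the_equality)
  fix D assume "GDERIV E x :> D"
  then have "(\<lambda>h. h \<bullet> D) = (\<lambda>h. h \<bullet> G x)"
    using E_GDERIV unfolding gderiv_def by (rule has_derivative_unique)
  then show "D = G x" by (metis (mono_tags) inner_commute vector_eq_ldot)
qed (rule E_GDERIV)

lemma continuous_E: "isCont E x"
  using E_GDERIV gderiv_def has_derivative_continuous by blast

text \<open>A zero of \<open>G\<close> is its own proximal point, so \<open>g\<close> falls below
  \<open>g x\<close> by at most a multiple of \<open>(norm (y - x))\<^sup>2\<close> and the
  difference quotient has a nonnegative lower limit. Constant sequences pass from the regular to the
  limiting subdifferential.\<close>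

lemma stationary_point_if_G_zero:
  assumes "G x = 0"
  shows "stationary_point g x"
proof -
  have Px: "P x = x" using assms lam_pos unfolding G_def by simp
  then obtain gx where gx: "g x = ereal gx" using g_prox[of x] by auto
  define l where "l = 1 / (2 * lam)"
  have "0 \<le> Liminf (at x) (\<lambda>y. (g y - g x - ereal (0 \<bullet> (y - x))) / ereal (norm (y - x)))"
    unfolding le_Liminf_iff
  proof (intro allI impI)
    fix c :: ereal assume "c < 0"
    then obtain c' where c': "c < ereal c'" "ereal c' < 0" using ereal_dense2 by blast
    then have "c' < 0" by simp
    have "((\<lambda>y. - l * norm (y - x)) \<longlongrightarrow> - l * norm (x - x)) (at x)" by (intro tendsto_intros)
    then have "eventually (\<lambda>y. c' < - l * norm (y - x)) (at x)"
      using \<open>c' < 0\<close> by (intro order_tendstoD(1)) auto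
    moreover have "eventually (\<lambda>y. y \<noteq> x) (at x)" by (simp add: eventually_at_filter)
    ultimately show "eventually (\<lambda>y. c < (g y - g x - ereal (0 \<bullet> (y - x))) / ereal (norm (y - x))) (at x)"
    proof eventually_elim
      case (elim y)
      have n: "0 < norm (y - x)" using elim by simp
      show ?case
      proof (cases "g y")
        case (real gy)
        have "gx \<le> gy + l * (norm (y - x))\<^sup>2"
          using prox_minimizes[of x y] Px gx real unfolding l_def by simp
        then have "- l * norm (y - x) \<le> (gy - gx) / norm (y - x)"
          using n by (simp add: field_simps power2_eq_square)
        with elim have "c' < (gy - gx) / norm (y - x)" by linarith
        then have "ereal c' < (g y - g x - ereal (0 \<bullet> (y - x))) / ereal (norm (y - x))"
          using real gx n by simp
        with c'(1) show ?thesis by (rule less_trans)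
      next
        case PInf
        then have "(g y - g x - ereal (0 \<bullet> (y - x))) / ereal (norm (y - x)) = \<infinity>"
          using n gx by simp
        then show ?thesis using c'(1) by (metis ereal_infty_less(1) less_ereal.simps(2) less_trans)
      qed (use g_not_minf in auto)
    qed
  qed
  then have "0 \<in> regular_subdiff g x" unfolding regular_subdiff_def using gx by simp
  then show ?thesis unfolding stationary_point_def limiting_subdiff_def using gx
    by (simp, intro exI[of _ "\<lambda>_. x"] conjI exI[of _ "\<lambda>_. 0"]) auto
qed

end

subsection \<open>Descent sequences with the KL property\<close>

lemma accumulation_point_near:
  fixes x :: "nat \<Rightarrow> 'a::metric_space"
  assumes "accumulation_point x a" "0 < \<delta>"
  obtains k where "N \<le> k" "dist (x k) a < \<delta>"
proof -
  obtain s where s: "strict_mono s" "(x \<circ> s) \<longlonglongrightarrow> a"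
    using assms(1) unfolding accumulation_point_def by auto
  then have "eventually (\<lambda>n. dist (x (s n)) a < \<delta>) sequentially"
    using assms(2) by (auto simp: tendsto_iff)
  then obtain M where "\<And>n. M \<le> n \<Longrightarrow> dist (x (s n)) a < \<delta>"
    unfolding eventually_sequentially by auto
  with seq_suble[OF s(1), of "max M N"] that[of "s (max M N)"] show thesis by simp
qed

text \<open>The method is constrained only from index 1 on, so general results on sequences are
  applied to the shifted iterates. As \<open>s (Suc n)\<close> is positive, taking its predecessor
  is harmless.\<close>

lemma accumulation_point_Suc:
  assumes "accumulation_point x a"
  shows "accumulation_point (\<lambda>n. x (Suc n)) a"
proof -
  obtain s where s: "strict_mono s" "(x \<circ> s) \<longlonglongrightarrow> a"
    using assms unfolding accumulation_point_def by auto
  have pos: "0 < s (Suc n)" for n using seq_suble[OF s(1), of "Suc n"] by simp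
  have "strict_mono (\<lambda>n. s (Suc n) - 1)"
  proof (rule strict_monoI)
    fix m n :: nat assume "m < n"
    then have "s (Suc m) < s (Suc n)" using s(1) by (simp add: strict_mono_def)
    with pos[of m] show "s (Suc m) - 1 < s (Suc n) - 1" by simp
  qed
  moreover have "(\<lambda>n. x (Suc n)) \<circ> (\<lambda>n. s (Suc n) - 1) = (\<lambda>n. (x \<circ> s) (Suc n))"
    using pos by (auto simp: fun_eq_iff)
  moreover have "(\<lambda>n. (x \<circ> s) (Suc n)) \<longlonglongrightarrow> a" using s(2) by (rule LIMSEQ_Suc)
  ultimately show ?thesis unfolding accumulation_point_def by metis
qed

text \<open>Continuity gives the limit along the subsequence, and a decreasing real sequence
  inherits the limit of any subsequence and stays above it.\<close>

lemma decseq_accumulation_tendsto: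
  fixes h :: "'a::metric_space \<Rightarrow> real"
  assumes "decseq (\<lambda>k. h (x k))" "accumulation_point x a" "isCont h a"
  shows "(\<lambda>k. h (x k)) \<longlonglongrightarrow> h a" and "h a \<le> h (x k)"
proof -
  obtain s where s: "strict_mono s" "(x \<circ> s) \<longlonglongrightarrow> a"
    using assms(2) unfolding accumulation_point_def by auto
  have lim: "(\<lambda>n. h (x (s n))) \<longlonglongrightarrow> h a"
    using isCont_tendsto_compose[OF assms(3) s(2)] by (simp add: o_def)
  have ge: "h a \<le> h (x k)" for k
  proof (rule tendsto_upperbound[OF lim])
    show "eventually (\<lambda>n. h (x (s n)) \<le> h (x k)) sequentially"
      unfolding eventually_sequentially
      using decseqD[OF assms(1)] seq_suble[OF s(1)] by (meson le_trans)
  qed simp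
  show "h a \<le> h (x k)" by (rule ge)
  show "(\<lambda>k. h (x k)) \<longlonglongrightarrow> h a"
  proof (rule decreasing_tendsto)
    fix c assume "h a < c"
    then obtain n where "h (x (s n)) < c"
      using order_tendstoD(2)[OF lim] by (metis eventually_happens' sequentially_bot)
    then show "eventually (\<lambda>k. h (x k) < c) sequentially"
      unfolding eventually_sequentially using decseqD[OF assms(1)] by (meson le_less_trans)
  qed (simp add: ge)
qed

text \<open>This is the tangent inequality of a concave function. It is applied on the open convex
  set \<open>A\<close>, which omits 0 because differentiability of \<open>\<psi>\<close> is given
  only at positive arguments.\<close>

lemma KL_with_tangent:
  assumes "KL_with h a \<eta> \<psi>" "0 < u" "ereal u < \<eta>" "0 < v" "ereal v < \<eta>"
  shows "deriv \<psi> u * (u - v) \<le> \<psi> u - \<psi> v"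
proof -
  define A where "A = {s. 0 < s \<and> ereal s < \<eta>}"
  have openA: "open A"
  proof (cases \<eta>)
    case (real r)
    then have "A = {0<..<r}" by (auto simp: A_def)
    then show ?thesis by simp
  next
    case PInf
    then have "A = {0<..}" by (auto simp: A_def)
    then show ?thesis by simp
  qed (simp add: A_def)
  have "convex A" unfolding A_def convex_def
  proof (intro ballI allI impI, clarify)
    fix x y s t :: real
    assume *: "0 < x" "ereal x < \<eta>" "0 < y" "ereal y < \<eta>" "0 \<le> s" "0 \<le> t" "s + t = 1"
    have pos: "0 < s * x + t * y" using * by (cases "s = 0") (auto intro: add_pos_nonneg)
    have "s * x + t * y \<le> max x y"
      using * convex_bound_le[of x "max x y" y s t] by simp
    then have "ereal (s * x + t * y) \<le> ereal (max x y)" by (simp del: ereal_max)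
    also have "\<dots> < \<eta>" using * by (auto simp: max_def)
    finally have "ereal (s * x + t * y) < \<eta>" .
    with pos show "0 < s *\<^sub>R x + t *\<^sub>R y \<and> ereal (s *\<^sub>R x + t *\<^sub>R y) < \<eta>" by simp
  qed
  have "concave_on {s. 0 \<le> s \<and> ereal s < \<eta>} \<psi>" using assms(1) unfolding KL_with_def by simp
  then have "convex_on A (\<lambda>s. - \<psi> s)"
    unfolding concave_on_def by (rule convex_on_subset[OF _ _ \<open>convex A\<close>]) (auto simp: A_def)
  moreover have "\<psi> C1_differentiable_on A" using assms(1) unfolding KL_with_def A_def by simp
  then obtain D where "(\<psi> has_vector_derivative D) (at u)"
    using assms unfolding C1_differentiable_on_def A_def by blast
  then have D: "(\<psi> has_field_derivative D) (at u)"
    unfolding has_real_derivative_iff_has_vector_derivative .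
  then have "((\<lambda>s. - \<psi> s) has_field_derivative - D) (at u within A)"
    by (rule has_field_derivative_at_within[OF DERIV_minus])
  ultimately have "- D * (v - u) \<le> - \<psi> v - - \<psi> u"
    using assms openA convex_connected[OF \<open>convex A\<close>]
    by (intro convex_on_imp_above_tangent[of A]) (auto simp: interior_open A_def)
  then show ?thesis using DERIV_imp_deriv[OF D] by (simp add: algebra_simps)
qed

text \<open>Concavity of \<open>\<psi>\<close> turns the descent condition into a bound on the step length by the
  decrease of \<open>\<psi> (h (x k) - h a)\<close>, which telescopes and hence keeps the sequence near \<open>a\<close>.\<close>

lemma KL_descent:
  fixes x :: "nat \<Rightarrow> 'a::real_inner"
  assumes kl: "KL_with h a \<eta> \<psi>" and cont: "isCont h a" and acc: "accumulation_point x a"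
    and \<sigma>: "0 < \<sigma>"
    and descent: "\<And>k. \<sigma> * norm (gradient h (x k)) * norm (x (Suc k) - x k) \<le> h (x k) - h (x (Suc k))"
    and above: "\<And>k. h a < h (x k)"
  shows "eventually (\<lambda>k. ereal (h (x k) - h a) < \<eta> \<and>
      1 \<le> deriv \<psi> (h (x k) - h a) * norm (gradient h (x k)) \<and>
      \<sigma> * norm (x k - a) \<le> \<psi> (h (x k) - h a)) sequentially"
    and "x \<longlonglongrightarrow> a"
proof -
  define D where "D k = h (x k) - h a" for k
  have D_pos: "0 < D k" for k using above[of k] by (simp add: D_def)
  have D_step: "\<sigma> * norm (gradient h (x k)) * norm (x (Suc k) - x k) \<le> D k - D (Suc k)" for k
    using descent[of k] by (simp add: D_def)
  have "0 \<le> \<sigma> * norm (gradient h (x k)) * norm (x (Suc k) - x k)" for k using \<sigma> by simp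
  then have "h (x (Suc k)) \<le> h (x k)" for k using descent[of k] by (meson diff_ge_0_iff_ge order_trans)
  then have "decseq (\<lambda>k. h (x k))" by (rule decseq_SucI)
  then have "(\<lambda>k. h (x k)) \<longlonglongrightarrow> h a" by (rule decseq_accumulation_tendsto) fact+
  then have "(\<lambda>k. h (x k) - h a) \<longlonglongrightarrow> 0" by (rule LIM_zero)
  then have D_lim: "D \<longlonglongrightarrow> 0" by (simp add: D_def[abs_def])
  have \<eta>: "0 < \<eta>" and \<psi>0: "\<psi> 0 = 0" and \<psi>_nonneg: "\<And>s. 0 \<le> s \<Longrightarrow> ereal s < \<eta> \<Longrightarrow> 0 \<le> \<psi> s"
    and \<psi>_cont: "continuous_on {s. 0 \<le> s \<and> ereal s < \<eta>} \<psi>"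
    and \<psi>'_pos: "\<And>s. 0 < s \<Longrightarrow> ereal s < \<eta> \<Longrightarrow> 0 < deriv \<psi> s"
    using kl unfolding KL_with_def by auto
  obtain U where U: "open U" "a \<in> U" "\<And>y. y \<in> U \<Longrightarrow> h a < h y \<Longrightarrow> ereal (h y) < ereal (h a) + \<eta> \<Longrightarrow>
      1 \<le> deriv \<psi> (h y - h a) * norm (gradient h y)"
    using kl unfolding KL_with_def by blast
  obtain \<delta> where \<delta>: "0 < \<delta>" "ball a \<delta> \<subseteq> U" using U by (meson openE)
  have "(\<lambda>k. ereal (D k)) \<longlonglongrightarrow> ereal 0" using D_lim by (rule tendsto_ereal)
  then have small: "eventually (\<lambda>k. ereal (D k) < \<eta>) sequentially"
    using \<eta> by (intro order_tendstoD(2)) (auto simp: zero_ereal_def[symmetric])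
  have "(\<lambda>k. \<psi> (D k)) \<longlonglongrightarrow> \<psi> 0"
    using small \<eta> D_pos
    by (intro continuous_on_tendsto_compose[OF \<psi>_cont D_lim])
      (auto simp: zero_ereal_def[symmetric] less_imp_le elim!: eventually_mono)
  then have \<psi>_lim: "(\<lambda>k. \<psi> (D k)) \<longlonglongrightarrow> 0" using \<psi>0 by simp
  \<comment> \<open>Half of \<open>\<delta>\<close> is reserved for the distance of
    \<open>x K\<close> from \<open>a\<close>, the other half for all later movement.\<close>
  then have "eventually (\<lambda>k. \<psi> (D k) < \<sigma> * (\<delta> / 2)) sequentially"
    using \<sigma> \<delta> by (intro order_tendstoD(2)) auto
  with small have "eventually (\<lambda>k. ereal (D k) < \<eta> \<and> \<psi> (D k) < \<sigma> * (\<delta> / 2)) sequentially"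
    by (rule eventually_conj)
  then obtain K0 where K0: "\<And>k. K0 \<le> k \<Longrightarrow> ereal (D k) < \<eta> \<and> \<psi> (D k) < \<sigma> * (\<delta> / 2)"
    unfolding eventually_sequentially by blast
  obtain K where K: "K0 \<le> K" "dist (x K) a < \<delta> / 2"
    using accumulation_point_near[OF acc, of "\<delta> / 2" K0] \<delta>(1) by auto
  have grad: "1 \<le> deriv \<psi> (D k) * norm (gradient h (x k))" if "K \<le> k" "x k \<in> ball a \<delta>" for k
  proof -
    have "ereal (D k) < \<eta>" using K0 K that by simp
    then have "ereal (h (x k)) < ereal (h a) + \<eta>" unfolding D_def by (cases \<eta>) auto
    then show ?thesis unfolding D_def using that \<delta> above by (intro U(3)) auto
  qed
  have step: "\<sigma> * norm (x (Suc k) - x k) \<le> \<psi> (D k) - \<psi> (D (Suc k))"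
    if "K \<le> k" "x k \<in> ball a \<delta>" for k
  proof -
    have \<eta>k: "ereal (D k) < \<eta>" "ereal (D (Suc k)) < \<eta>" using K0 K that by auto
    have "\<sigma> * norm (x (Suc k) - x k) * 1
      \<le> \<sigma> * norm (x (Suc k) - x k) * (deriv \<psi> (D k) * norm (gradient h (x k)))"
      using grad[OF that] \<sigma> by (intro mult_left_mono) auto
    also have "\<dots> = deriv \<psi> (D k) * (\<sigma> * norm (gradient h (x k)) * norm (x (Suc k) - x k))"
      by (simp add: mult_ac)
    also have "\<dots> \<le> deriv \<psi> (D k) * (D k - D (Suc k))"
      using D_step \<psi>'_pos[OF D_pos \<eta>k(1)] by (intro mult_left_mono) auto
    also have "\<dots> \<le> \<psi> (D k) - \<psi> (D (Suc k))"
      using KL_with_tangent[OF kl D_pos \<eta>k(1) D_pos \<eta>k(2)] .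
    finally show ?thesis by simp
  qed
  have path: "\<sigma> * norm (x (m + n) - x m) \<le> \<psi> (D m) - \<psi> (D (m + n))"
    if "\<And>i. i < n \<Longrightarrow> x (m + i) \<in> ball a \<delta>" "K \<le> m" for m n
    using that(1)
  proof (induction n)
    case (Suc n)
    have "norm (x (m + Suc n) - x m) \<le> norm (x (Suc (m + n)) - x (m + n)) + norm (x (m + n) - x m)"
      using norm_triangle_ineq[of "x (Suc (m + n)) - x (m + n)" "x (m + n) - x m"] by simp
    then have "\<sigma> * norm (x (m + Suc n) - x m)
      \<le> \<sigma> * norm (x (Suc (m + n)) - x (m + n)) + \<sigma> * norm (x (m + n) - x m)"
      using \<sigma> by (simp flip: distrib_left)
    also have "\<dots> \<le> (\<psi> (D (m + n)) - \<psi> (D (Suc (m + n)))) + (\<psi> (D m) - \<psi> (D (m + n)))"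
      using step[of "m + n"] Suc that(2) by (intro add_mono) auto
    finally show ?case by simp
  qed simp
  \<comment> \<open>The step bound is available only inside the ball. Strong induction resolves the
    circularity: if all earlier iterates lie in the ball, the telescoped bound keeps the next one
    there.\<close>
  have trapped: "x (K + n) \<in> ball a \<delta>" for n
  proof (induction n rule: less_induct)
    case (less n)
    have "\<sigma> * norm (x (K + n) - x K) \<le> \<psi> (D K) - \<psi> (D (K + n))"
      using path[of n K] less by simp
    also have "\<dots> \<le> \<psi> (D K)" using \<psi>_nonneg[of "D (K + n)"] D_pos[of "K + n"] K0[of "K + n"] K by auto
    also have "\<dots> < \<sigma> * (\<delta> / 2)" using K0 K by simp
    finally have "norm (x (K + n) - x K) < \<delta> / 2" using \<sigma> by simp
    with K(2) have "dist (x (K + n)) a < \<delta>"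
      using dist_triangle_half_r[of "x K" "x (K + n)" \<delta> a] by (simp add: dist_norm norm_minus_commute)
    then show ?case by (simp add: dist_commute)
  qed
  have in_ball: "x k \<in> ball a \<delta>" if "K \<le> k" for k
    using trapped[of "k - K"] that by simp
  obtain s where s: "strict_mono s" "(x \<circ> s) \<longlonglongrightarrow> a"
    using acc unfolding accumulation_point_def by auto
  \<comment> \<open>The distance to \<open>a\<close> is the limit of the distances to the members of
    the subsequence, each of which is bounded by telescoping; convergence of the whole sequence then
    follows.\<close>
  have bound: "\<sigma> * norm (x k - a) \<le> \<psi> (D k)" if "K \<le> k" for k
  proof -
    have "(\<lambda>n. \<sigma> * norm (x k - (x \<circ> s) n)) \<longlonglongrightarrow> \<sigma> * norm (x k - a)"
      by (intro tendsto_intros s)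
    moreover have "\<sigma> * norm (x k - (x \<circ> s) n) \<le> \<psi> (D k)" if "k \<le> n" for n
    proof -
      have sn: "k \<le> s n" using seq_suble[OF s(1), of n] that by simp
      have "\<sigma> * norm (x (k + (s n - k)) - x k) \<le> \<psi> (D k) - \<psi> (D (k + (s n - k)))"
        using in_ball \<open>K \<le> k\<close> by (intro path) auto
      also have "\<dots> \<le> \<psi> (D k)"
        using \<psi>_nonneg[of "D (s n)"] D_pos[of "s n"] K0[of "s n"] K \<open>K \<le> k\<close> sn by auto
      finally show ?thesis using sn by (simp add: norm_minus_commute)
    qed
    then have "eventually (\<lambda>n. \<sigma> * norm (x k - (x \<circ> s) n) \<le> \<psi> (D k)) sequentially"
      unfolding eventually_sequentially by blast
    ultimately show ?thesis by (rule tendsto_upperbound) simp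
  qed
  have "(\<lambda>k. norm (x k - a)) \<longlonglongrightarrow> 0"
  proof (rule tendsto_sandwich[of "\<lambda>_. 0"])
    show "(\<lambda>k. \<psi> (D k) / \<sigma>) \<longlonglongrightarrow> 0" using tendsto_divide[OF \<psi>_lim tendsto_const[of \<sigma>]] \<sigma> by simp
    show "eventually (\<lambda>k. norm (x k - a) \<le> \<psi> (D k) / \<sigma>) sequentially"
      unfolding eventually_sequentially using bound \<sigma> by (auto simp: field_simps)
  qed auto
  then show "x \<longlonglongrightarrow> a" by (rule LIM_zero_cancel[OF tendsto_norm_zero_cancel])
  show "eventually (\<lambda>k. ereal (h (x k) - h a) < \<eta> \<and>
      1 \<le> deriv \<psi> (h (x k) - h a) * norm (gradient h (x k)) \<and>
      \<sigma> * norm (x k - a) \<le> \<psi> (h (x k) - h a)) sequentially"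
    unfolding eventually_sequentially D_def[symmetric]
    using bound grad in_ball K0 K(1) by (intro exI[of _ K]) auto
qed

section \<open>Rates from scalar recursions\<close>

lemma linear_rate:
  fixes \<Delta> :: "nat \<Rightarrow> real"
  assumes "0 < \<beta>" "eventually (\<lambda>k. \<Delta> (Suc k) \<le> \<beta> * \<Delta> k) sequentially"
  obtains C where "0 < C" "eventually (\<lambda>k. \<Delta> k \<le> C * \<beta> ^ k) sequentially"
proof -
  obtain K where K: "\<And>k. K \<le> k \<Longrightarrow> \<Delta> (Suc k) \<le> \<beta> * \<Delta> k"
    using assms(2) unfolding eventually_sequentially by blast
  define C where "C = (\<bar>\<Delta> K\<bar> + 1) / \<beta> ^ K"
  have "\<Delta> k \<le> C * \<beta> ^ k" if "K \<le> k" for k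
    using that
  proof (induction k rule: dec_induct)
    case base
    then show ?case using assms(1) by (simp add: C_def)
  next
    case (step k)
    have "\<Delta> (Suc k) \<le> \<beta> * \<Delta> k" using K step by simp
    also have "\<dots> \<le> \<beta> * (C * \<beta> ^ k)" using step assms(1) by (intro mult_left_mono) auto
    finally show ?case by (simp add: mult_ac)
  qed
  moreover have "0 < C" using assms(1) by (simp add: C_def)
  ultimately show thesis using that eventually_sequentially by blast
qed

text \<open>The convex function \<open>s powr (1 - a)\<close> lies above its tangent at
  \<open>u\<close>. This replaces integrating the differential inequality behind the sublinear
  rate.\<close>

lemma powr_above_tangent:
  fixes u v a :: real
  assumes "1 < a" "0 < u" "0 < v"
  shows "(a - 1) * u powr (- a) * (u - v) \<le> v powr (1 - a) - u powr (1 - a)"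
proof -
  have "convex_on {0<..} (\<lambda>s::real. s powr (1 - a))"
  proof (rule f''_ge0_imp_convex)
    fix s :: real assume s: "s \<in> {0<..}"
    show "((\<lambda>s. s powr (1 - a)) has_real_derivative (1 - a) * s powr (- a)) (at s)"
      using s by (auto intro!: derivative_eq_intros)
    show "((\<lambda>s. (1 - a) * s powr (- a)) has_real_derivative (1 - a) * (- a * s powr (- a - 1))) (at s)"
      using s by (auto intro!: derivative_eq_intros)
    show "0 \<le> (1 - a) * (- a * s powr (- a - 1))"
      using assms(1) by (simp add: mult_nonpos_nonneg)
  qed auto
  moreover have "((\<lambda>s. s powr (1 - a)) has_real_derivative (1 - a) * u powr (- a)) (at u within {0<..})"
    using assms by (auto intro!: derivative_eq_intros)
  ultimately have "((1 - a) * u powr (- a)) * (v - u) \<le> v powr (1 - a) - u powr (1 - a)"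
    using assms by (intro convex_on_imp_above_tangent[of "{0<..}"]) (auto simp: interior_open)
  then show ?thesis by (simp add: algebra_simps)
qed

text \<open>The quantity \<open>\<Delta> k powr (1 - a)\<close> grows by at least \<open>c * (a - 1)\<close> in each step.\<close>

lemma sublinear_rate:
  fixes \<Delta> :: "nat \<Rightarrow> real"
  assumes "1 < a" "0 < c" "0 < b" "\<And>k. 0 < \<Delta> k"
    and "eventually (\<lambda>k. c * \<Delta> k powr a \<le> \<Delta> k - \<Delta> (Suc k)) sequentially"
  obtains C where "0 < C" "eventually (\<lambda>k. \<Delta> k powr b \<le> C * real k powr (- (b / (a - 1)))) sequentially"
proof -
  obtain K where K: "\<And>k. K \<le> k \<Longrightarrow> c * \<Delta> k powr a \<le> \<Delta> k - \<Delta> (Suc k)"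
    using assms(5) unfolding eventually_sequentially by blast
  define e where "e = c * (a - 1)"
  have e: "0 < e" using assms by (simp add: e_def)
  have growth: "e \<le> \<Delta> (Suc k) powr (1 - a) - \<Delta> k powr (1 - a)" if "K \<le> k" for k
  proof -
    have "e = (a - 1) * \<Delta> k powr (- a) * (c * \<Delta> k powr a)"
      using assms(4)[of k] by (simp add: e_def powr_minus field_simps)
    also have "\<dots> \<le> (a - 1) * \<Delta> k powr (- a) * (\<Delta> k - \<Delta> (Suc k))"
      using K[OF that] assms(1) by (intro mult_left_mono) auto
    also have "\<dots> \<le> \<Delta> (Suc k) powr (1 - a) - \<Delta> k powr (1 - a)"
      using assms by (intro powr_above_tangent) auto
    finally show ?thesis .
  qed
  have sum: "e * (real k - real K) \<le> \<Delta> k powr (1 - a)" if "K \<le> k" for k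
    using that
  proof (induction k rule: dec_induct)
    case (step k)
    then show ?case using growth[of k] by (simp add: algebra_simps)
  qed simp
  \<comment> \<open>From \<open>2 * K + 1\<close> on, \<open>k - K\<close> is at least
    \<open>k / 2\<close>, which absorbs the shift; also \<open>k\<close> is positive, as the
    negative exponent requires.\<close>
  have "\<Delta> k powr b \<le> (e / 2) powr (- (b / (a - 1))) * real k powr (- (b / (a - 1)))"
    if k: "2 * K + 1 \<le> k" for k
  proof -
    have "e / 2 * real k \<le> e * (real k - real K)"
    proof -
      have "e * (real k / 2) \<le> e * (real k - real K)" using k e by (intro mult_left_mono) auto
      then show ?thesis by simp
    qed
    also have "\<dots> \<le> \<Delta> k powr (1 - a)" using k by (intro sum) auto
    finally have "\<Delta> k powr (1 - a) \<ge> e / 2 * real k" .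
    then have "(\<Delta> k powr (1 - a)) powr (- (b / (a - 1))) \<le> (e / 2 * real k) powr (- (b / (a - 1)))"
      using e k assms by (intro powr_mono2') auto
    moreover have "(1 - a) * (- (b / (a - 1))) = b" using assms(1) by (simp add: field_simps)
    ultimately have "\<Delta> k powr b \<le> (e / 2 * real k) powr (- (b / (a - 1)))" by (simp only: powr_powr)
    also have "\<dots> = (e / 2) powr (- (b / (a - 1))) * real k powr (- (b / (a - 1)))"
      by (rule powr_mult)
    finally show ?thesis .
  qed
  then show thesis using that[of "(e / 2) powr (- (b / (a - 1)))"] e eventually_sequentially by auto
qed

subsection \<open>The inexact proximal point method\<close>

lemma infinite_enumerate_gap:
  assumes "infinite S" "enumerate S n < i" "i < enumerate S (Suc n)"
  shows "i \<notin> S"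
  using assms not_less_Least[of i "\<lambda>s. s \<in> S \<and> enumerate S n < s"]
  by (simp add: enumerate_Suc'')

text \<open>Between consecutive non-null indices the iterate does not move. Hence a one-step
  estimate at a non-null index is an estimate between consecutive members of the
  subsequence.\<close>

lemma nonnull_iterate_Suc:
  assumes "infinite (nonnull_iterations x)" "1 \<le> k"
  shows "nonnull_iterate x (Suc k) = x (Suc (enumerate (nonnull_iterations x) (k - 1)))"
proof -
  let ?e = "enumerate (nonnull_iterations x)"
  have const: "x i = x (Suc (?e (k - 1)))" if "Suc (?e (k - 1)) \<le> i" "i \<le> ?e k" for i
    using that
  proof (induction i rule: dec_induct)
    case (step i)
    then have "i \<notin> nonnull_iterations x"
      using assms by (intro infinite_enumerate_gap[of _ "k - 1"]) auto
    then have "x (Suc i) = x i" using step unfolding nonnull_iterations_def null_iterations_def by auto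
    then show ?case using step by simp
  qed simp
  have "?e (k - 1) < ?e k" using enumerate_step[OF assms(1), of "k - 1"] assms(2) by simp
  then have "x (?e k) = x (Suc (?e (k - 1)))" by (intro const) auto
  then show ?thesis unfolding nonnull_iterate_def by simp
qed

locale inexact_ppm_run = weakly_convex_prox +
  fixes \<tau>1 \<tau>2 \<mu> \<theta> :: real and x p d :: "nat \<Rightarrow> 'a" and t r \<epsilon> :: "nat \<Rightarrow> real"
  assumes tau: "0 < \<tau>1" "\<tau>1 \<le> \<tau>2" "\<tau>2 < 2 * lam"
    and init: "0 < \<epsilon> 1" "0 < r 1" "\<epsilon> 1 \<le> r 1"
    and mu: "0 < \<mu>" "\<mu> < 1" and theta: "0 < \<theta>" "\<theta> \<le> \<mu>"
    and run: "inexact_ppm g lam \<tau>1 \<tau>2 \<mu> \<theta> x p d t r \<epsilon>"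
begin

section \<open>Descent estimates for a single iteration\<close>

definition gk :: "nat \<Rightarrow> 'a" where "gk k = inverse lam *\<^sub>R (x k - p k)"

lemma run_step:
  assumes "1 \<le> k"
  shows "norm (p k - P (x k)) \<le> lam * \<epsilon> k"
    and "\<tau>1 \<le> t k" "t k \<le> \<tau>2" "x (Suc k) = x k + t k *\<^sub>R d k"
    and "norm (gk k) \<le> r k + \<epsilon> k \<and> r (Suc k) = \<mu> * r k \<and> \<epsilon> (Suc k) = \<theta> * \<epsilon> k \<and> d k = 0 \<or>
      \<not> norm (gk k) \<le> r k + \<epsilon> k \<and> r (Suc k) = r k \<and> \<epsilon> (Suc k) = \<epsilon> k \<and>
        d k = - (((norm (gk k) - \<epsilon> k) / norm (gk k)) *\<^sub>R gk k)"
  using run assms unfolding inexact_ppm_def Let_def gk_def by (auto split: if_splits)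

text \<open>A null step multiplies the tolerance by \<open>\<theta>\<close> and the radius by
  \<open>\<mu>\<close>, which preserves the initial order because
  \<open>\<theta> \<le> \<mu>\<close>. The invariant lets the error of \<open>gk\<close> be absorbed
  by the radius.\<close>

lemma tolerance_le_radius:
  assumes "1 \<le> k"
  shows "0 < \<epsilon> k \<and> \<epsilon> k \<le> r k"
  using assms
proof (induction k rule: dec_induct)
  case (step k)
  have "\<theta> * \<epsilon> k \<le> \<mu> * r k" using step mu theta by (intro mult_mono) auto
  with run_step(5)[of k] step theta show ?case by auto
qed (use init in simp)

lemma gk_error:
  assumes "1 \<le> k"
  shows "norm (G (x k) - gk k) \<le> \<epsilon> k"
proof -
  have "G (x k) - gk k = inverse lam *\<^sub>R (p k - P (x k))"
    unfolding G_def gk_def by (simp add: algebra_simps)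
  then have "norm (G (x k) - gk k) = norm (p k - P (x k)) / lam"
    using lam_pos by (simp add: divide_inverse mult.commute)
  also have "\<dots> \<le> \<epsilon> k" using run_step(1)[OF assms] lam_pos by (simp add: field_simps)
  finally show ?thesis .
qed

text \<open>Outside the null branch \<open>norm (gk k)\<close> exceeds \<open>\<epsilon> k\<close>,
  so the direction is nonzero. In the null branch the gradient is at most
  \<open>r k + 2 * \<epsilon> k\<close>.\<close>

lemma null_step_gradient:
  assumes "1 \<le> k" "d k = 0"
  shows "norm (G (x k)) \<le> 3 * r k" "r (Suc k) = \<mu> * r k"
proof -
  have small: "norm (gk k) \<le> r k + \<epsilon> k"
  proof (rule ccontr)
    assume big: "\<not> norm (gk k) \<le> r k + \<epsilon> k"
    then have "0 < norm (gk k)" "\<epsilon> k < norm (gk k)" using tolerance_le_radius[OF assms(1)] by auto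
    then show False using run_step(5)[OF assms(1)] assms(2) big by auto
  qed
  then show "r (Suc k) = \<mu> * r k" using run_step(5)[OF assms(1)] by auto
  show "norm (G (x k)) \<le> 3 * r k"
    using small gk_error[OF assms(1)] tolerance_le_radius[OF assms(1)]
      norm_triangle_ineq[of "G (x k) - gk k" "gk k"] by simp
qed

text \<open>Here \<open>norm (d k) = norm (gk k) - \<epsilon> k\<close> exceeds \<open>r k\<close>,
  hence \<open>\<epsilon> k\<close>, and the gradient is at most
  \<open>norm (d k) + 2 * \<epsilon> k\<close>. In the inner product, shortening the direction by
  \<open>\<epsilon> k\<close> exactly offsets the error of \<open>gk\<close>.\<close>

lemma nonnull_step_direction:
  assumes "1 \<le> k" "d k \<noteq> 0"
  shows "norm (G (x k)) \<le> 3 * norm (d k)" "G (x k) \<bullet> d k \<le> - (norm (d k))\<^sup>2"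
proof -
  have big: "r k + \<epsilon> k < norm (gk k)" and d: "d k = - (((norm (gk k) - \<epsilon> k) / norm (gk k)) *\<^sub>R gk k)"
    using run_step(5)[OF assms(1)] assms(2) by auto
  have pos: "0 < norm (gk k)" "\<epsilon> k < norm (gk k)" "0 < \<epsilon> k" "\<epsilon> k \<le> r k"
    using tolerance_le_radius[OF assms(1)] big by auto
  have nd: "norm (d k) = norm (gk k) - \<epsilon> k" unfolding d using pos by simp
  show "norm (G (x k)) \<le> 3 * norm (d k)"
    using nd pos big gk_error[OF assms(1)] norm_triangle_ineq[of "G (x k) - gk k" "gk k"] by simp
  have "gk k \<bullet> d k = - ((norm (gk k) - \<epsilon> k) / norm (gk k) * (gk k \<bullet> gk k))" unfolding d by simp
  also have "gk k \<bullet> gk k = norm (gk k) * norm (gk k)" by (simp add: dot_square_norm power2_eq_square)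
  finally have 1: "gk k \<bullet> d k = - (norm (d k) * norm (gk k))" using nd pos by simp
  have "(G (x k) - gk k) \<bullet> d k \<le> norm (G (x k) - gk k) * norm (d k)" by (rule norm_cauchy_schwarz)
  also have "\<dots> \<le> \<epsilon> k * norm (d k)" using gk_error[OF assms(1)] by (intro mult_right_mono) auto
  finally have "G (x k) \<bullet> d k \<le> - (norm (d k) * norm (gk k)) + \<epsilon> k * norm (d k)"
    using 1 by (simp add: inner_diff_left)
  also have "norm (gk k) = norm (d k) + \<epsilon> k" using nd by simp
  also have "- (norm (d k) * (norm (d k) + \<epsilon> k)) + \<epsilon> k * norm (d k) = - (norm (d k))\<^sup>2"
    by (simp add: power2_eq_square algebra_simps)
  finally show "G (x k) \<bullet> d k \<le> - (norm (d k))\<^sup>2" .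
qed

lemma step_null_iff:
  assumes "1 \<le> k"
  shows "x (Suc k) = x k \<longleftrightarrow> d k = 0"
  using run_step(2,4)[OF assms] tau by auto

text \<open>A lower bound for \<open>t * (1 - t / (2 * lam))\<close> over the admissible step sizes,
  positive because \<open>\<tau>2 < 2 * lam\<close>.\<close>

definition \<kappa> :: real where "\<kappa> = \<tau>1 * (1 - \<tau>2 / (2 * lam))"

lemma \<kappa>_pos: "0 < \<kappa>"
  unfolding \<kappa>_def using tau lam_pos by simp

lemma sufficient_decrease:
  assumes "1 \<le> k"
  shows "\<kappa> * (norm (d k))\<^sup>2 \<le> E (x k) - E (x (Suc k))"
proof (cases "d k = 0")
  case True
  then show ?thesis using run_step(4)[OF assms] by simp
next
  case False
  note s = run_step(2-4)[OF assms]
  define D where "D = (norm (d k))\<^sup>2"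
  have "t k * (1 - t k / (2 * lam)) \<ge> \<tau>1 * (1 - \<tau>2 / (2 * lam))"
    using s tau lam_pos by (intro mult_mono) (auto simp: field_simps)
  then have "\<kappa> * D \<le> t k * (1 - t k / (2 * lam)) * D"
    unfolding \<kappa>_def D_def by (intro mult_right_mono) auto
  moreover have "E (x (Suc k)) \<le> E (x k) + t k * (G (x k) \<bullet> d k) + 1 / (2 * lam) * ((t k)\<^sup>2 * D)"
    using E_upper[of "x (Suc k)" "x k"] s(3) by (simp add: D_def power_mult_distrib)
  moreover have "t k * (G (x k) \<bullet> d k) \<le> t k * - D"
    unfolding D_def using nonnull_step_direction(2)[OF assms False] s tau by (intro mult_left_mono) auto
  moreover have "t k * (1 - t k / (2 * lam)) * D = t k * D - 1 / (2 * lam) * ((t k)\<^sup>2 * D)"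
    by (simp add: algebra_simps power2_eq_square)
  ultimately show ?thesis unfolding D_def by simp
qed

lemma E_decreases:
  assumes "1 \<le> k"
  shows "E (x (Suc k)) \<le> E (x k)"
proof -
  have "0 \<le> \<kappa> * (norm (d k))\<^sup>2" using \<kappa>_pos by simp
  with sufficient_decrease[OF assms] show ?thesis by linarith
qed

text \<open>The form of descent that \<open>KL_descent\<close> expects: both the gradient and the
  step length are bounded by multiples of \<open>norm (d k)\<close>, with factors 3 and
  \<open>\<tau>2\<close>.\<close>

lemma strong_descent:
  assumes "1 \<le> k"
  shows "\<kappa> / (3 * \<tau>2) * norm (G (x k)) * norm (x (Suc k) - x k) \<le> E (x k) - E (x (Suc k))"
proof (cases "d k = 0")
  case True
  then show ?thesis using run_step(4)[OF assms] by simp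
next
  case False
  have "norm (x (Suc k) - x k) \<le> \<tau>2 * norm (d k)"
    using run_step(2-4)[OF assms] tau by (simp add: mult_right_mono)
  then have "norm (G (x k)) * norm (x (Suc k) - x k) \<le> (3 * norm (d k)) * (\<tau>2 * norm (d k))"
    using nonnull_step_direction(1)[OF assms False] by (intro mult_mono) auto
  then have "\<kappa> / (3 * \<tau>2) * (norm (G (x k)) * norm (x (Suc k) - x k))
    \<le> \<kappa> / (3 * \<tau>2) * ((3 * norm (d k)) * (\<tau>2 * norm (d k)))"
    using \<kappa>_pos tau by (intro mult_left_mono) auto
  also have "\<dots> = \<kappa> * (norm (d k))\<^sup>2" using tau by (simp add: power2_eq_square)
  finally show ?thesis using sufficient_decrease[OF assms] by (simp add: mult.assoc)
qed

text \<open>From some index on every iteration is null, so the radii \<open>r k\<close>, which bound the gradient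
  there, decay geometrically.\<close>

lemma finite_nonnull_limit:
  assumes fin: "finite (nonnull_iterations x)" and acc: "accumulation_point x a"
  shows "x \<longlonglongrightarrow> a" "G a = 0"
proof -
  obtain K0 where K0: "\<forall>k\<in>nonnull_iterations x. k \<le> K0"
    using fin finite_nat_set_iff_bounded_le by blast
  have null: "x (Suc k) = x k" if "Suc K0 \<le> k" for k
  proof -
    have "k \<notin> nonnull_iterations x" using K0 that by (meson not_less_eq_eq)
    then show ?thesis using that unfolding nonnull_iterations_def null_iterations_def by auto
  qed
  have const: "x k = x (Suc K0)" if "Suc K0 \<le> k" for k
    using that by (induction k rule: dec_induct) (auto simp: null)
  then have "eventually (\<lambda>k. x k = x (Suc K0)) sequentially"
    unfolding eventually_sequentially by blast
  then have lim: "x \<longlonglongrightarrow> x (Suc K0)" by (rule tendsto_eventually)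
  obtain s where "strict_mono s" "(x \<circ> s) \<longlonglongrightarrow> a"
    using acc unfolding accumulation_point_def by auto
  then have a: "x (Suc K0) = a"
    using LIMSEQ_unique[OF LIMSEQ_subseq_LIMSEQ[OF lim]] by blast
  with lim show "x \<longlonglongrightarrow> a" by simp
  have "eventually (\<lambda>k. r (Suc k) \<le> \<mu> * r k) sequentially"
    unfolding eventually_sequentially
    using null step_null_iff null_step_gradient(2) by (intro exI[of _ "Suc K0"]) auto
  then obtain C where C: "eventually (\<lambda>k. r k \<le> C * \<mu> ^ k) sequentially"
    using linear_rate mu(1) by metis
  have "(\<lambda>k. C * \<mu> ^ k) \<longlonglongrightarrow> 0"
    using mu by (intro tendsto_mult_right_zero LIMSEQ_power_zero) auto
  then have "(\<lambda>k. 3 * (C * \<mu> ^ k)) \<longlonglongrightarrow> 0" by (rule tendsto_mult_right_zero)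
  moreover have "eventually (\<lambda>k. norm (G a) \<le> 3 * (C * \<mu> ^ k)) sequentially"
    using C eventually_ge_at_top[of "Suc K0"]
  proof eventually_elim
    case (elim k)
    have "norm (G (x k)) \<le> 3 * r k"
      using elim null step_null_iff by (intro null_step_gradient(1)) auto
    then show ?case using elim const[of k] a by simp
  qed
  ultimately have "norm (G a) \<le> 0" by (rule tendsto_lowerbound) simp
  then show "G a = 0" by simp
qed

text \<open>The KL inequality applies only strictly above the limit value. Strictness holds because
  some later non-null step decreases \<open>E\<close> strictly.\<close>

lemma E_above_limit:
  assumes inf: "infinite (nonnull_iterations x)" and acc: "accumulation_point x a" and k: "1 \<le> k"
  shows "E a < E (x k)"
proof -
  have "decseq (\<lambda>n. E (x (Suc n)))" by (intro decseq_SucI E_decreases) simp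
  from decseq_accumulation_tendsto(2)[OF this accumulation_point_Suc[OF acc] continuous_E]
    decseqD[OF this]
  have ge: "E a \<le> E (x (Suc n))" and mono: "m \<le> n \<Longrightarrow> E (x (Suc n)) \<le> E (x (Suc m))" for m n by auto
  obtain n where n: "n \<in> nonnull_iterations x" "k \<le> n"
    using inf by (metis finite_nat_set_iff_bounded_le nat_le_linear)
  then have n1: "1 \<le> n" "d n \<noteq> 0"
    using step_null_iff[of n] unfolding nonnull_iterations_def null_iterations_def by auto
  have "0 < \<kappa> * (norm (d n))\<^sup>2" using \<kappa>_pos n1 by simp
  then have "E (x (Suc n)) < E (x n)" using sufficient_decrease[OF n1(1)] by linarith
  moreover have "E (x n) \<le> E (x k)" using mono[of "k - 1" "n - 1"] n n1 k by simp
  ultimately show ?thesis using ge[of n] by linarith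
qed

section \<open>Convergence and stationarity with infinitely many non-null iterations\<close>

context
  fixes xbar :: 'a and \<eta> :: ereal and \<psi> :: "real \<Rightarrow> real"
  assumes inf: "infinite (nonnull_iterations x)" and acc: "accumulation_point x xbar"
    and kl: "KL_with E xbar \<eta> \<psi>"
begin

lemma infinite_nonnull_KL:
  shows "eventually (\<lambda>k. ereal (E (x k) - E xbar) < \<eta> \<and>
      1 \<le> deriv \<psi> (E (x k) - E xbar) * norm (G (x k)) \<and>
      \<kappa> / (3 * \<tau>2) * norm (x k - xbar) \<le> \<psi> (E (x k) - E xbar)) sequentially"
    and "x \<longlonglongrightarrow> xbar"
proof -
  have \<sigma>: "0 < \<kappa> / (3 * \<tau>2)" using \<kappa>_pos tau by simp
  have descent: "\<kappa> / (3 * \<tau>2) * norm (gradient E (x (Suc k))) * norm (x (Suc (Suc k)) - x (Suc k))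
      \<le> E (x (Suc k)) - E (x (Suc (Suc k)))" for k
    unfolding gradient_E by (rule strong_descent) simp
  have above: "E xbar < E (x (Suc k))" for k by (rule E_above_limit[OF inf acc]) simp
  \<comment> \<open>The descent result is applied to the sequence shifted by one, since index 0 is
    unconstrained; the shift is undone afterwards.\<close>
  note KL = KL_descent[OF kl continuous_E accumulation_point_Suc[OF acc] \<sigma>, OF descent above]
  show "x \<longlonglongrightarrow> xbar" using KL(2) by (rule LIMSEQ_imp_Suc)
  show "eventually (\<lambda>k. ereal (E (x k) - E xbar) < \<eta> \<and>
      1 \<le> deriv \<psi> (E (x k) - E xbar) * norm (G (x k)) \<and>
      \<kappa> / (3 * \<tau>2) * norm (x k - xbar) \<le> \<psi> (E (x k) - E xbar)) sequentially"
    by (subst eventually_sequentially_Suc[symmetric]) (rule KL(1)[unfolded gradient_E])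
qed

text \<open>The factor 9 is the square of the factor 3 relating the gradient to the
  direction.\<close>

lemma nonnull_iterate_facts:
  assumes "1 \<le> k"
  shows "E xbar < E (nonnull_iterate x k)"
    and "\<kappa> / 9 * (norm (G (nonnull_iterate x k)))\<^sup>2 \<le> E (nonnull_iterate x k) - E (nonnull_iterate x (Suc k))"
proof -
  define j where "j = enumerate (nonnull_iterations x) (k - 1)"
  have z: "nonnull_iterate x k = x j" "nonnull_iterate x (Suc k) = x (Suc j)"
    using nonnull_iterate_Suc[OF inf assms] unfolding nonnull_iterate_def j_def by auto
  have "j \<in> nonnull_iterations x" unfolding j_def using inf by (rule enumerate_in_set)
  then have j: "1 \<le> j" "d j \<noteq> 0"
    using step_null_iff[of j] unfolding nonnull_iterations_def null_iterations_def by auto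
  show "E xbar < E (nonnull_iterate x k)" unfolding z by (rule E_above_limit[OF inf acc j(1)])
  have "(norm (G (x j)))\<^sup>2 \<le> (3 * norm (d j))\<^sup>2"
    using nonnull_step_direction(1)[OF j] by (intro power_mono) auto
  then have "\<kappa> / 9 * (norm (G (x j)))\<^sup>2 \<le> \<kappa> / 9 * (3 * norm (d j))\<^sup>2"
    using \<kappa>_pos by (intro mult_left_mono) auto
  also have "\<dots> = \<kappa> * (norm (d j))\<^sup>2" by (simp add: power_mult_distrib)
  finally show "\<kappa> / 9 * (norm (G (nonnull_iterate x k)))\<^sup>2
      \<le> E (nonnull_iterate x k) - E (nonnull_iterate x (Suc k))"
    unfolding z using sufficient_decrease[OF j(1)] by linarith
qed

lemma filterlim_nonnull_index:
  "filterlim (\<lambda>k. enumerate (nonnull_iterations x) (k - 1)) sequentially sequentially"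
proof (rule filterlim_at_top_mono[OF filterlim_minus_const_nat_at_top[of 1]])
  show "\<forall>\<^sub>F k in sequentially. k - 1 \<le> enumerate (nonnull_iterations x) (k - 1)"
    using le_enumerate[OF inf] by simp
qed

text \<open>Successive differences of the convergent values of \<open>E\<close> tend to 0 and
  dominate the squared gradients along the non-null iterates; continuity of \<open>G\<close> gives
  the claim.\<close>

lemma G_limit_zero: "G xbar = 0"
proof -
  let ?z = "nonnull_iterate x"
  have z_lim: "?z \<longlonglongrightarrow> xbar"
    unfolding nonnull_iterate_def
    by (rule filterlim_compose[OF infinite_nonnull_KL(2) filterlim_nonnull_index])
  then have "(\<lambda>k. E (?z k)) \<longlonglongrightarrow> E xbar" by (rule isCont_tendsto_compose[OF continuous_E])
  from tendsto_diff[OF this LIMSEQ_Suc[OF this]]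
  have dE: "(\<lambda>k. E (?z k) - E (?z (Suc k))) \<longlonglongrightarrow> 0" by simp
  have "isCont G xbar" using continuous_G by (simp add: continuous_on_eq_continuous_at)
  then have dG: "(\<lambda>k. \<kappa> / 9 * (norm (G (?z k)))\<^sup>2) \<longlonglongrightarrow> \<kappa> / 9 * (norm (G xbar))\<^sup>2"
    using z_lim by (intro tendsto_intros isCont_tendsto_compose[of _ G])
  have "eventually (\<lambda>k. \<kappa> / 9 * (norm (G (?z k)))\<^sup>2 \<le> E (?z k) - E (?z (Suc k))) sequentially"
    using eventually_ge_at_top[of 1] by (rule eventually_mono) (rule nonnull_iterate_facts)
  then have "\<kappa> / 9 * (norm (G xbar))\<^sup>2 \<le> 0" by (rule tendsto_le[OF sequentially_bot dE dG])
  then show ?thesis using \<kappa>_pos by (auto simp: mult_le_0_iff)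
qed

section \<open>Rates for power desingularizing functions\<close>

context
  fixes M q :: real
  assumes M: "0 < M" and q: "0 < q" "q < 1"
    and \<psi>_powr: "\<And>s. 0 \<le> s \<Longrightarrow> ereal s < \<eta> \<Longrightarrow> \<psi> s = M * s powr (1 - q)"
begin

lemma deriv_\<psi>:
  assumes "0 < s" "ereal s < \<eta>"
  shows "deriv \<psi> s = M * (1 - q) * s powr (- q)"
proof -
  \<comment> \<open>The formula for \<open>\<psi>\<close> is known only below \<open>\<eta>\<close>;
    a real \<open>u\<close> between \<open>s\<close> and \<open>\<eta>\<close> gives an open
    interval on which to transfer the derivative, also for infinite \<open>\<eta>\<close>.\<close>
  obtain u where u: "s < u" "ereal u < \<eta>"
    using ereal_dense2[OF assms(2)] by auto
  have "((\<lambda>s. M * s powr (1 - q)) has_field_derivative M * (1 - q) * s powr (- q)) (at s)"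
    using assms(1) by (auto intro!: derivative_eq_intros)
  then have "(\<psi> has_field_derivative M * (1 - q) * s powr (- q)) (at s)"
  proof (rule has_field_derivative_transform_within_open)
    fix v assume v: "v \<in> {0<..<u}"
    then have "ereal v < \<eta>" using u(2) by (auto intro: less_trans[of _ "ereal u"])
    with v show "M * v powr (1 - q) = \<psi> v" using \<psi>_powr[of v] by simp
  qed (use u assms in auto)
  then show ?thesis by (rule DERIV_imp_deriv)
qed

text \<open>The gap at index 0, where \<^const>\<open>nonnull_iterate\<close> is irrelevant, is only made positive.\<close>

definition gap :: "nat \<Rightarrow> real" where
  "gap k = (if k = 0 then 1 else E (nonnull_iterate x k) - E xbar)"

lemma gap_pos: "0 < gap k"
  unfolding gap_def using nonnull_iterate_facts(1)[of k] by auto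

lemma gap_tendsto: "gap \<longlonglongrightarrow> 0"
proof -
  have "nonnull_iterate x \<longlonglongrightarrow> xbar"
    unfolding nonnull_iterate_def
    by (rule filterlim_compose[OF infinite_nonnull_KL(2) filterlim_nonnull_index])
  then have "(\<lambda>k. E (nonnull_iterate x k) - E xbar) \<longlonglongrightarrow> 0"
    by (intro LIM_zero isCont_tendsto_compose[OF continuous_E])
  moreover have "eventually (\<lambda>k. E (nonnull_iterate x k) - E xbar = gap k) sequentially"
    using eventually_gt_at_top[of 0] by (rule eventually_mono) (simp add: gap_def)
  ultimately show ?thesis by (rule Lim_transform_eventually)
qed

text \<open>The KL inequality reads \<open>gap k powr q \<le> m * norm (G z)\<close> at the iterate
  \<open>z\<close>, with \<open>m = M * (1 - q)\<close>. Its square combined with sufficient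
  decrease gives the recursion; the distance bound comes from the telescoping argument.\<close>

lemma gap_recursion:
  obtains c B where "0 < c" "0 < B"
    "eventually (\<lambda>k. c * gap k powr (2 * q) \<le> gap k - gap (Suc k)) sequentially"
    "eventually (\<lambda>k. norm (nonnull_iterate x k - xbar) \<le> B * gap k powr (1 - q)) sequentially"
proof
  let ?z = "nonnull_iterate x"
  define \<sigma> where "\<sigma> = \<kappa> / (3 * \<tau>2)"
  have \<sigma>: "0 < \<sigma>" using \<kappa>_pos tau by (simp add: \<sigma>_def)
  define m where "m = M * (1 - q)"
  have m: "0 < m" using M q by (simp add: m_def)
  show "0 < \<kappa> / 9 / m\<^sup>2" "0 < M / \<sigma>" using \<kappa>_pos m M \<sigma> by auto
  have ev: "eventually (\<lambda>k. ereal (E (?z k) - E xbar) < \<eta> \<and>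
      1 \<le> deriv \<psi> (E (?z k) - E xbar) * norm (G (?z k)) \<and>
      \<sigma> * norm (?z k - xbar) \<le> \<psi> (E (?z k) - E xbar)) sequentially"
    using eventually_compose_filterlim[OF infinite_nonnull_KL(1) filterlim_nonnull_index]
    unfolding nonnull_iterate_def \<sigma>_def .
  show "eventually (\<lambda>k. \<kappa> / 9 / m\<^sup>2 * gap k powr (2 * q) \<le> gap k - gap (Suc k)) sequentially"
    using ev eventually_ge_at_top[of 1]
  proof eventually_elim
    case (elim k)
    then have g: "E (?z k) - E xbar = gap k" "E (?z (Suc k)) - E xbar = gap (Suc k)" by (auto simp: gap_def)
    have "1 \<le> m * gap k powr (- q) * norm (G (?z k))"
      using elim deriv_\<psi>[of "gap k"] gap_pos[of k] unfolding g m_def by auto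
    then have "gap k powr q \<le> gap k powr q * (m * gap k powr (- q) * norm (G (?z k)))"
      using mult_left_mono[of 1 _ "gap k powr q"] by simp
    also have "\<dots> = m * norm (G (?z k))" using gap_pos[of k] by (simp add: powr_minus)
    finally have "(gap k powr q)\<^sup>2 \<le> (m * norm (G (?z k)))\<^sup>2" by (intro power_mono) auto
    moreover have "(gap k powr q)\<^sup>2 = gap k powr (2 * q)"
      using gap_pos[of k] by (simp add: powr_power mult.commute)
    ultimately have "\<kappa> / 9 / m\<^sup>2 * gap k powr (2 * q) \<le> \<kappa> / 9 / m\<^sup>2 * (m * norm (G (?z k)))\<^sup>2"
      using \<kappa>_pos by (intro mult_left_mono) auto
    also have "\<dots> = \<kappa> / 9 * (norm (G (?z k)))\<^sup>2" using m by (simp add: power_mult_distrib)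
    also have "\<dots> \<le> gap k - gap (Suc k)"
      using nonnull_iterate_facts(2)[of k] elim g by simp
    finally show ?case .
  qed
  show "eventually (\<lambda>k. norm (?z k - xbar) \<le> M / \<sigma> * gap k powr (1 - q)) sequentially"
    using ev eventually_ge_at_top[of 1]
  proof eventually_elim
    case (elim k)
    then have g: "E (?z k) - E xbar = gap k" by (auto simp: gap_def)
    have "\<sigma> * norm (?z k - xbar) \<le> M * gap k powr (1 - q)"
      using elim \<psi>_powr[of "gap k"] gap_pos[of k] unfolding g by auto
    then show ?case using \<sigma> by (simp add: field_simps)
  qed
qed

text \<open>Once the gap is below 1, \<open>2 * q \<le> 1\<close> makes
  \<open>gap k powr (2 * q)\<close> at least \<open>gap k\<close>, so the recursion is a
  contraction.\<close>

lemma linear_convergence: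
  assumes "q \<le> 1 / 2"
  shows "\<exists>c>0. \<exists>\<beta>. 0 < \<beta> \<and> \<beta> < 1 \<and>
    (\<forall>\<^sub>F k in sequentially. norm (nonnull_iterate x k - xbar) \<le> c * \<beta> ^ k)"
proof -
  obtain c B where c: "0 < c" "0 < B"
    "eventually (\<lambda>k. c * gap k powr (2 * q) \<le> gap k - gap (Suc k)) sequentially"
    "eventually (\<lambda>k. norm (nonnull_iterate x k - xbar) \<le> B * gap k powr (1 - q)) sequentially"
    by (rule gap_recursion)
  \<comment> \<open>Since \<open>c\<close> may exceed 1, it is capped at \<open>1 / 2\<close> to
    keep the ratio positive.\<close>
  define b where "b = 1 - min c (1 / 2)"
  have b: "0 < b" "b < 1" using c(1) by (auto simp: b_def)
  have "eventually (\<lambda>k. gap k < 1) sequentially"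
    using gap_tendsto by (rule order_tendstoD) simp
  with c(3) have "eventually (\<lambda>k. gap (Suc k) \<le> b * gap k) sequentially"
  proof eventually_elim
    case (elim k)
    have "gap k powr 1 \<le> gap k powr (2 * q)"
      using elim gap_pos[of k] assms by (intro powr_mono') auto
    then have "min c (1 / 2) * gap k \<le> c * gap k powr (2 * q)"
      using c(1) gap_pos[of k] by (intro mult_mono) auto
    then show ?case using elim unfolding b_def by (simp add: algebra_simps)
  qed
  then obtain C where C: "0 < C" "eventually (\<lambda>k. gap k \<le> C * b ^ k) sequentially"
    using linear_rate[OF b(1)] by metis
  have "eventually (\<lambda>k. norm (nonnull_iterate x k - xbar) \<le> B * C powr (1 - q) * (b powr (1 - q)) ^ k) sequentially"
    using C(2) c(4)
  proof eventually_elim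
    case (elim k)
    have "gap k powr (1 - q) \<le> (C * b ^ k) powr (1 - q)"
      using elim gap_pos[of k] q by (intro powr_mono2) auto
    also have "\<dots> = C powr (1 - q) * (b powr (1 - q)) ^ k"
      using b C(1) by (simp add: powr_mult powr_power flip: powr_realpow) (simp add: powr_powr mult.commute)
    finally have "B * gap k powr (1 - q) \<le> B * (C powr (1 - q) * (b powr (1 - q)) ^ k)"
      using c(2) by (intro mult_left_mono) auto
    then show ?case using elim by (simp add: mult.assoc)
  qed
  moreover have "0 < B * C powr (1 - q)" using c C by simp
  moreover have "b powr (1 - q) < 1" "0 < b powr (1 - q)" using b q powr_less_mono2[of "1 - q" b 1] by auto
  ultimately show ?thesis by blast
qed

text \<open>The recursion has exponent \<open>2 * q\<close> greater than 1, so
  \<open>sublinear_rate\<close> applies with that exponent and the power \<open>1 - q\<close> from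
  the distance bound.\<close>

lemma sublinear_convergence:
  assumes "1 / 2 < q"
  shows "\<exists>\<gamma>>0. \<forall>\<^sub>F k in sequentially.
    norm (nonnull_iterate x k - xbar) \<le> \<gamma> * real k powr (- ((1 - q) / (2 * q - 1)))"
proof -
  obtain c B where c: "0 < c" "0 < B"
    "eventually (\<lambda>k. c * gap k powr (2 * q) \<le> gap k - gap (Suc k)) sequentially"
    "eventually (\<lambda>k. norm (nonnull_iterate x k - xbar) \<le> B * gap k powr (1 - q)) sequentially"
    by (rule gap_recursion)
  obtain C where C: "0 < C"
    "eventually (\<lambda>k. gap k powr (1 - q) \<le> C * real k powr (- ((1 - q) / (2 * q - 1)))) sequentially"
    by (rule sublinear_rate[of "2 * q" c "1 - q" gap]) (use assms q c gap_pos in auto)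
  have "eventually (\<lambda>k. norm (nonnull_iterate x k - xbar)
      \<le> B * C * real k powr (- ((1 - q) / (2 * q - 1)))) sequentially"
    using C(2) c(4)
  proof eventually_elim
    case (elim k)
    have "B * gap k powr (1 - q) \<le> B * (C * real k powr (- ((1 - q) / (2 * q - 1))))"
      using elim c(2) by (intro mult_left_mono) auto
    then show ?case using elim by (simp add: mult.assoc)
  qed
  then show ?thesis using c(2) C(1) by (intro exI[of _ "B * C"]) simp
qed

end
end
end

theorem theorem3p12:
  fixes g :: "'a::euclidean_space \<Rightarrow> ereal"
    and \<rho> lam \<tau>1 \<tau>2 \<mu> \<theta> :: real
    and x p d :: "nat \<Rightarrow> 'a"
    and t r \<epsilon> :: "nat \<Rightarrow> real"
    and xbar :: 'a
    and \<eta> :: ereal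
    and \<psi> :: "real \<Rightarrow> real"
  assumes "0 \<le> \<rho>"
    and "weakly_convex \<rho> g"
    and "0 < lam" and "ereal lam < inverse (ereal \<rho>)"
    and "0 < \<tau>1" and "\<tau>1 \<le> \<tau>2" and "\<tau>2 < 2 * lam"
    and "0 < \<epsilon> 1" and "0 < r 1"
    and "0 < \<mu>" and "\<mu> < 1" and "0 < \<theta>" and "\<theta> < 1"
    and "\<epsilon> 1 \<le> r 1" and "\<theta> \<le> \<mu>"
    and "inexact_ppm g lam \<tau>1 \<tau>2 \<mu> \<theta> x p d t r \<epsilon>"
    and "accumulation_point x xbar"
    and "KL_with (\<lambda>y. real_of_ereal (moreau_envelope lam g y)) xbar \<eta> \<psi>"
  shows "x \<longlonglongrightarrow> xbar \<and> stationary_point g xbar \<and>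
    (\<forall>M q. infinite (nonnull_iterations x) \<and> 0 < M \<and> 0 < q \<and> q < 1 \<and>
        (\<forall>s. 0 \<le> s \<and> ereal s < \<eta> \<longrightarrow> \<psi> s = M * s powr (1 - q)) \<longrightarrow>
      (q \<le> 1 / 2 \<longrightarrow>
        (\<exists>c>0. \<exists>\<beta>. 0 < \<beta> \<and> \<beta> < 1 \<and>
          (\<forall>\<^sub>F k in sequentially. norm (nonnull_iterate x k - xbar) \<le> c * \<beta> ^ k))) \<and>
      (1 / 2 < q \<longrightarrow>
        (\<exists>\<gamma>>0. \<forall>\<^sub>F k in sequentially.
          norm (nonnull_iterate x k - xbar) \<le> \<gamma> * real k powr (- ((1 - q) / (2 * q - 1))))))"
proof -
  \<comment> \<open>For \<open>\<rho> = 0\<close> the inverse is infinite; the product form covers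
    both cases.\<close>
  have "lam * \<rho> < 1"
  proof (cases "\<rho> = 0")
    case False
    then have "lam < inverse \<rho>" using assms(4) by simp
    then show ?thesis using False assms(1) by (simp add: field_simps)
  qed simp
  then interpret inexact_ppm_run g \<rho> lam \<tau>1 \<tau>2 \<mu> \<theta> x p d t r \<epsilon>
    using assms by unfold_locales
  note acc = assms(17)
  have kl: "KL_with E xbar \<eta> \<psi>" using assms(18) unfolding E_def .
  have "x \<longlonglongrightarrow> xbar \<and> G xbar = 0"
  \<comment> \<open>With finitely many non-null iterations the sequence is eventually constant and
    the radii force a zero gradient; otherwise the KL argument applies.\<close>
  proof (cases "finite (nonnull_iterations x)")
    case True
    then show ?thesis using finite_nonnull_limit acc by simp
  next
    case False
    then show ?thesis using infinite_nonnull_KL(2)[OF False acc kl] G_limit_zero[OF False acc kl] by simp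
  qed
  then have "x \<longlonglongrightarrow> xbar" "stationary_point g xbar"
    using stationary_point_if_G_zero by auto
  then show ?thesis
  proof (intro conjI allI impI; (elim conjE)?)
    fix M q :: real
    assume "infinite (nonnull_iterations x)" "0 < M" "0 < q" "q < 1" "q \<le> 1 / 2"
      and "\<forall>s. 0 \<le> s \<and> ereal s < \<eta> \<longrightarrow> \<psi> s = M * s powr (1 - q)"
    then show "\<exists>c>0. \<exists>\<beta>. 0 < \<beta> \<and> \<beta> < 1 \<and>
        (\<forall>\<^sub>F k in sequentially. norm (nonnull_iterate x k - xbar) \<le> c * \<beta> ^ k)"
      by (intro linear_convergence[OF _ acc kl, of M q]) auto
  next
    fix M q :: real
    assume "infinite (nonnull_iterations x)" "0 < M" "0 < q" "q < 1" "1 / 2 < q"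
      and "\<forall>s. 0 \<le> s \<and> ereal s < \<eta> \<longrightarrow> \<psi> s = M * s powr (1 - q)"
    then show "\<exists>\<gamma>>0. \<forall>\<^sub>F k in sequentially.
        norm (nonnull_iterate x k - xbar) \<le> \<gamma> * real k powr (- ((1 - q) / (2 * q - 1)))"
      by (intro sublinear_convergence[OF _ acc kl, of M q]) auto
  qed
qed

end
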